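(* The semisimple Boolean inverse semigroups are, up to isomorphism, precisely those of the form $\mathsf{K}_{\mathrm{fin}}(G)$ where $G$ is a discrete groupoid. That is, a Boolean inverse semigroup $S$ is semisimple if and only if there is a discrete groupoid $G$ such that $S\cong\mathsf{K}_{\mathrm{fin}}(G)$.
   Context: For an inverse semigroup $S$, $\mathsf{E}(S)$ is its set of idempotents. The natural partial order is $a\le b$ iff $a=ba^{-1}a$; joins and meets refer to it; $a^{\downarrow}=\{x: x\le a\}$. Elements $a,b$ are compatible if $a^{-1}b$ and $ab^{-1}$ are both idempotents. A Boolean algebra here means a generalized Boolean algebra: a distributive lattice with bottom (a top is not required) in which every principal order-ideal is a (unital) Boolean algebra. An inverse semigroup with zero is distributive if any two compatible elements have a join and multiplication distributes on both sides over such joins; it is Boolean if in addition $(\mathsf{E}(S),\le)$ is a Boolean algebra. Boolean inverse semigroups are assumed not to be the zero semigroup $\{0\}$. $S$ is semisimple if $a^{\downarrow}$ is finite for each $a\in S$. A groupoid is a small category in which every arrow is invertible, with objects identified with identities; $\mathbf{d}(x)=x^{-1}x$, $\mathbf{r}(x)=xx^{-1}$. A discrete groupoid is a groupoid with the discrete topology (i.e. just a groupoid). A subset $A$ of a groupoid $G$ is a local bisection if for $a,b\in A$, $\mathbf{d}(a)=\mathbf{d}(b)$ implies $a=b$ and $\mathbf{r}(a)=\mathbf{r}(b)$ implies $a=b$ (the empty set is a local bisection). $\mathsf{K}_{\mathrm{fin}}(G)$ is the set of all finite local bisections of $G$ with multiplication $AB=\{ab: a\in A, b\in B, \mathbf{d}(a)=\mathbf{r}(b)\}$.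 *)

theory Defs
  imports "HOL-Algebra.Lattice"
begin

section \<open>Generalized Boolean algebras\<close>

locale distributive_lattice = lattice L for L (structure) +
  assumes meet_join_distrib:
    "\<lbrakk>x \<in> carrier L; y \<in> carrier L; z \<in> carrier L\<rbrakk> \<Longrightarrow> x \<sqinter> (y \<squnion> z) = (x \<sqinter> y) \<squnion> (x \<sqinter> z)"

locale unital_boolean_algebra = distributive_lattice L + bounded_lattice L for L (structure) +
  assumes complement_exists:
    "x \<in> carrier L \<Longrightarrow> \<exists>y\<in>carrier L. x \<sqinter> y = \<bottom> \<and> x \<squnion> y = \<top>"

definition principal_ideal :: "('a, 'b) gorder_scheme \<Rightarrow> 'a \<Rightarrow> ('a, 'b) gorder_scheme" where
  "principal_ideal L e = L\<lparr>carrier := {x \<in> carrier L. x \<sqsubseteq>\<^bsub>L\<^esub> e}\<rparr>"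

locale generalized_boolean_algebra =
  distributive_lattice L + weak_partial_order_bottom L for L (structure) +
  assumes principal_ideal_boolean:
    "e \<in> carrier L \<Longrightarrow> unital_boolean_algebra (principal_ideal L e)"


section \<open>Boolean inverse semigroups\<close>

record 'a semigroup_on = "'a partial_object" +
  smul :: "'a \<Rightarrow> 'a \<Rightarrow> 'a" (infixl \<open>\<cdot>\<index>\<close> 70)

locale inverse_semigroup =
  fixes S (structure)
  assumes mult_closed: "\<lbrakk>a \<in> carrier S; b \<in> carrier S\<rbrakk> \<Longrightarrow> a \<cdot> b \<in> carrier S"
    and mult_assoc: "\<lbrakk>a \<in> carrier S; b \<in> carrier S; c \<in> carrier S\<rbrakk> \<Longrightarrow> a \<cdot> b \<cdot> c = a \<cdot> (b \<cdot> c)"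
    and unique_inverse: "a \<in> carrier S \<Longrightarrow> \<exists>!b. b \<in> carrier S \<and> a \<cdot> b \<cdot> a = a \<and> b \<cdot> a \<cdot> b = b"

definition sinv :: "('a, 'b) semigroup_on_scheme \<Rightarrow> 'a \<Rightarrow> 'a" where
  "sinv S a = (THE b. b \<in> carrier S \<and> a \<cdot>\<^bsub>S\<^esub> b \<cdot>\<^bsub>S\<^esub> a = a \<and> b \<cdot>\<^bsub>S\<^esub> a \<cdot>\<^bsub>S\<^esub> b = b)"

definition idempotents :: "('a, 'b) semigroup_on_scheme \<Rightarrow> 'a set" where
  "idempotents S = {e \<in> carrier S. e \<cdot>\<^bsub>S\<^esub> e = e}"

definition natural_order :: "('a, 'b) semigroup_on_scheme \<Rightarrow> 'a gorder" where
  "natural_order S =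
     \<lparr>carrier = carrier S, eq = (=), le = (\<lambda>a b. a = b \<cdot>\<^bsub>S\<^esub> sinv S a \<cdot>\<^bsub>S\<^esub> a)\<rparr>"

definition idempotent_order :: "('a, 'b) semigroup_on_scheme \<Rightarrow> 'a gorder" where
  "idempotent_order S = (natural_order S)\<lparr>carrier := idempotents S\<rparr>"

definition compatible :: "('a, 'b) semigroup_on_scheme \<Rightarrow> 'a \<Rightarrow> 'a \<Rightarrow> bool" where
  "compatible S a b \<longleftrightarrow>
     sinv S a \<cdot>\<^bsub>S\<^esub> b \<in> idempotents S \<and> a \<cdot>\<^bsub>S\<^esub> sinv S b \<in> idempotents S"

locale distributive_inverse_semigroup = inverse_semigroup S for S (structure) +
  assumes zero_exists: "\<exists>z\<in>carrier S. \<forall>a\<in>carrier S. z \<cdot> a = z \<and> a \<cdot> z = z"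
    and join_exists:
      "\<lbrakk>a \<in> carrier S; b \<in> carrier S; compatible S a b\<rbrakk> \<Longrightarrow> \<exists>j. is_lub (natural_order S) j {a, b}"
    and mult_join_distrib_left:
      "\<lbrakk>a \<in> carrier S; b \<in> carrier S; c \<in> carrier S; compatible S a b;
        is_lub (natural_order S) j {a, b}\<rbrakk> \<Longrightarrow> is_lub (natural_order S) (c \<cdot> j) {c \<cdot> a, c \<cdot> b}"
    and mult_join_distrib_right:
      "\<lbrakk>a \<in> carrier S; b \<in> carrier S; c \<in> carrier S; compatible S a b;
        is_lub (natural_order S) j {a, b}\<rbrakk> \<Longrightarrow> is_lub (natural_order S) (j \<cdot> c) {a \<cdot> c, b \<cdot> c}"

text \<open>The zero semigroup is excluded by convention.\<close>

locale boolean_inverse_semigroup = distributive_inverse_semigroup S for S (structure) +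
  assumes idempotents_boolean: "generalized_boolean_algebra (idempotent_order S)"
    and not_zero_semigroup: "\<nexists>z. carrier S = {z}"

definition semisimple :: "('a, 'b) semigroup_on_scheme \<Rightarrow> bool" where
  "semisimple S \<longleftrightarrow>
     (\<forall>a\<in>carrier S. finite {x \<in> carrier S. x \<sqsubseteq>\<^bsub>natural_order S\<^esub> a})"

definition semigroup_isomorphic ::
  "('a, 'c) semigroup_on_scheme \<Rightarrow> ('b, 'd) semigroup_on_scheme \<Rightarrow> bool" where
  "semigroup_isomorphic S T \<longleftrightarrow>
     (\<exists>f. bij_betw f (carrier S) (carrier T) \<and>
          (\<forall>a\<in>carrier S. \<forall>b\<in>carrier S. f (a \<cdot>\<^bsub>S\<^esub> b) = f a \<cdot>\<^bsub>T\<^esub> f b))"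


section \<open>Groupoids and their finite local bisections\<close>

text \<open>
  A groupoid is given by its set of arrows alone: objects are identified with identity arrows, so
  \<open>gdom\<close> and \<open>gran\<close> send an arrow to an arrow. The product \<open>gcomp G a b\<close> is the composite
  ``\<open>b\<close> first'' and is meaningful only if \<open>gdom G a = gran G b\<close>.
\<close>

record 'g groupoid =
  arrows :: "'g set"
  gdom :: "'g \<Rightarrow> 'g"
  gran :: "'g \<Rightarrow> 'g"
  gcomp :: "'g \<Rightarrow> 'g \<Rightarrow> 'g"

locale groupoid =
  fixes G :: "('g, 'b) groupoid_scheme"
  assumes dom_closed: "a \<in> arrows G \<Longrightarrow> gdom G a \<in> arrows G"
    and ran_closed: "a \<in> arrows G \<Longrightarrow> gran G a \<in> arrows G"
    and dom_ran_of_dom: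
      "a \<in> arrows G \<Longrightarrow> gdom G (gdom G a) = gdom G a \<and> gran G (gdom G a) = gdom G a"
    and dom_ran_of_ran:
      "a \<in> arrows G \<Longrightarrow> gdom G (gran G a) = gran G a \<and> gran G (gran G a) = gran G a"
    and comp_closed:
      "\<lbrakk>a \<in> arrows G; b \<in> arrows G; gdom G a = gran G b\<rbrakk> \<Longrightarrow> gcomp G a b \<in> arrows G"
    and dom_ran_of_comp:
      "\<lbrakk>a \<in> arrows G; b \<in> arrows G; gdom G a = gran G b\<rbrakk>
        \<Longrightarrow> gdom G (gcomp G a b) = gdom G b \<and> gran G (gcomp G a b) = gran G a"
    and comp_assoc:
      "\<lbrakk>a \<in> arrows G; b \<in> arrows G; c \<in> arrows G; gdom G a = gran G b; gdom G b = gran G c\<rbrakk>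
        \<Longrightarrow> gcomp G (gcomp G a b) c = gcomp G a (gcomp G b c)"
    and comp_dom: "a \<in> arrows G \<Longrightarrow> gcomp G a (gdom G a) = a"
    and comp_ran: "a \<in> arrows G \<Longrightarrow> gcomp G (gran G a) a = a"
    and invertible:
      "a \<in> arrows G \<Longrightarrow> \<exists>b\<in>arrows G. gdom G b = gran G a \<and> gran G b = gdom G a \<and>
         gcomp G b a = gdom G a \<and> gcomp G a b = gran G a"

definition local_bisection :: "('g, 'b) groupoid_scheme \<Rightarrow> 'g set \<Rightarrow> bool" where
  "local_bisection G A \<longleftrightarrow> A \<subseteq> arrows G \<and>
     (\<forall>a\<in>A. \<forall>b\<in>A. (gdom G a = gdom G b \<longrightarrow> a = b) \<and> (gran G a = gran G b \<longrightarrow> a = b))"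

definition Kfin :: "('g, 'b) groupoid_scheme \<Rightarrow> 'g set semigroup_on" where
  "Kfin G =
     \<lparr>carrier = {A. finite A \<and> local_bisection G A},
      smul = (\<lambda>A B. {gcomp G a b |a b. a \<in> A \<and> b \<in> B \<and> gdom G a = gran G b})\<rparr>"

end

theory Submission
  imports Defs
begin

text \<open>
  Let \<open>S\<close> be a semisimple Boolean inverse semigroup. Its atoms, the minimal nonzero elements for the
  natural order, form a groupoid: the object at the source of \<open>x\<close> is the idempotent \<open>x\<dagger> \<cdot> x\<close>, the object
  at its target is \<open>x \<cdot> x\<dagger>\<close>, and the product of \<open>S\<close> restricted to composable pairs is the composition
  (\<open>groupoid_atoms\<close>). The isomorphism sends \<open>a\<close> to the set of atoms below it. That set is finite because
  \<open>S\<close> is semisimple, and it is a local bisection because an element below \<open>a\<close> is determined by its source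
  and also by its target.

  The map is multiplicative (\<open>atoms_below_mult\<close>): an atom \<open>z\<close> below \<open>a \<cdot> b\<close> factors as a restriction of \<open>a\<close>
  times a restriction of \<open>b\<close>, and both restrictions are atoms since their sources or targets are squeezed
  under atomic idempotents. It is onto (\<open>atoms_below_surj\<close>): a finite local bisection of atoms is built up
  one atom at a time, since an atom that can be added to the bisection is orthogonal to the element built
  so far, so the join exists, and distributivity shows that this join acquires no further atoms.
  It is one-to-one because every \<open>a\<close> is the join of the atoms below it (\<open>atoms_below_subset_imp_below\<close>):
  if \<open>a\<close> is neither zero nor an atom, a relative complement in the Boolean algebra of idempotents splits
  it as a join of two strictly smaller elements, and the finiteness of \<open>a\<close>'s order ideal lets the
  splitting end.

  Conversely, in \<open>Kfin G\<close> the inverse of \<open>A\<close> is the set of inverse arrows, the natural order is inclusion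
  and the idempotents are the finite sets of identities. Order ideals are therefore finite, joins are
  unions, and the idempotents form the generalized Boolean algebra of finite subsets of a set. Semisimplicity
  passes through isomorphisms, because these preserve inverses and hence the natural order.
\<close>

section \<open>The natural partial order of an inverse semigroup\<close>

context inverse_semigroup
begin

abbreviation inverse_of ("_\<dagger>" [1000] 1000) where "a\<dagger> \<equiv> sinv S a"

lemma sinv_props:
  assumes "a \<in> carrier S"
  shows "a\<dagger> \<in> carrier S" "a \<cdot> a\<dagger> \<cdot> a = a" "a\<dagger> \<cdot> a \<cdot> a\<dagger> = a\<dagger>"
  using theI'[OF unique_inverse[OF assms]] unfolding sinv_def by auto

lemma sinv_equality:
  assumes "a \<in> carrier S" "b \<in> carrier S" "a \<cdot> b \<cdot> a = a" "b \<cdot> a \<cdot> b = b"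
  shows "a\<dagger> = b"
  using unique_inverse[OF assms(1)] sinv_props[OF assms(1)] assms by blast

lemma idemI: "e \<in> carrier S \<Longrightarrow> e \<cdot> e = e \<Longrightarrow> e \<in> idempotents S"
  by (simp add: idempotents_def)

lemma idem_closed: "e \<in> idempotents S \<Longrightarrow> e \<in> carrier S"
  and idem_mult: "e \<in> idempotents S \<Longrightarrow> e \<cdot> e = e"
  by (simp_all add: idempotents_def)

lemmas closed = mult_closed sinv_props(1)

lemma sinv_sinv: "a \<in> carrier S \<Longrightarrow> a\<dagger>\<dagger> = a"
  by (rule sinv_equality) (simp_all add: sinv_props)

lemma sinv_idem:
  assumes "e \<in> idempotents S" shows "e\<dagger> = e"
  by (rule sinv_equality) (simp_all add: assms idem_closed idem_mult)

lemma idem_left_mult: "e \<in> idempotents S \<Longrightarrow> a \<in> carrier S \<Longrightarrow> e \<cdot> (e \<cdot> a) = e \<cdot> a"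
  using idem_mult[of e] mult_assoc[of e e a] idem_closed[of e] by simp

text \<open>
  Let \<open>x\<close> be the inverse of \<open>e \<cdot> f\<close>. Then \<open>f \<cdot> x \<cdot> e\<close> is also an inverse of \<open>e \<cdot> f\<close>, so by uniqueness it equals
  \<open>x\<close>; in this form \<open>x\<close> is visibly idempotent. Idempotents are their own inverses, so \<open>e \<cdot> f = x\<close>.
\<close>
lemma idem_prod:
  assumes e: "e \<in> idempotents S" and f: "f \<in> idempotents S"
  shows "e \<cdot> f \<in> idempotents S"
proof -
  have ef: "e \<in> carrier S" "f \<in> carrier S" "e \<cdot> f \<in> carrier S"
    using e f idem_closed closed by blast+
  define x where "x = (e \<cdot> f)\<dagger>"
  have x: "x \<in> carrier S" "e \<cdot> f \<cdot> x \<cdot> (e \<cdot> f) = e \<cdot> f" "x \<cdot> (e \<cdot> f) \<cdot> x = x"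
    unfolding x_def using sinv_props[OF ef(3)] by blast+
  note s = mult_assoc mult_closed ef x(1) idem_left_mult[OF e] idem_left_mult[OF f]
  have cancel: "x \<cdot> (e \<cdot> (f \<cdot> (x \<cdot> a))) = x \<cdot> a" if "a \<in> carrier S" for a
    using arg_cong[OF x(3), of "\<lambda>t. t \<cdot> a"] that by (simp add: s)
  have "x = f \<cdot> (x \<cdot> e)"
    unfolding x_def
  proof (rule sinv_equality, unfold x_def[symmetric])
    show "e \<cdot> f \<cdot> (f \<cdot> (x \<cdot> e)) \<cdot> (e \<cdot> f) = e \<cdot> f"
      using x(2) by (simp add: s)
    show "f \<cdot> (x \<cdot> e) \<cdot> (e \<cdot> f) \<cdot> (f \<cdot> (x \<cdot> e)) = f \<cdot> (x \<cdot> e)"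
      by (simp add: s cancel)
  qed (simp_all add: s)
  moreover have "(f \<cdot> (x \<cdot> e)) \<cdot> (f \<cdot> (x \<cdot> e)) = f \<cdot> (x \<cdot> e)"
    by (simp add: s cancel)
  ultimately have "x \<in> idempotents S"
    unfolding idempotents_def using x(1) by auto
  then have "x\<dagger> \<in> idempotents S" by (simp add: sinv_idem)
  moreover have "x\<dagger> = e \<cdot> f"
    unfolding x_def by (rule sinv_sinv) (rule ef)
  ultimately show ?thesis by simp
qed

text \<open>
  Since products of idempotents are idempotent, \<open>f \<cdot> e\<close> satisfies the equations of the inverse of \<open>e \<cdot> f\<close>,
  which is \<open>e \<cdot> f\<close> itself.
\<close>
lemma idem_commute:
  assumes e: "e \<in> idempotents S" and f: "f \<in> idempotents S"
  shows "e \<cdot> f = f \<cdot> e"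
proof -
  note s = mult_assoc closed idem_closed[OF e] idem_closed[OF f] idem_left_mult[OF e] idem_left_mult[OF f]
  have "(e \<cdot> f)\<dagger> = f \<cdot> e"
  proof (rule sinv_equality)
    show "e \<cdot> f \<cdot> (f \<cdot> e) \<cdot> (e \<cdot> f) = e \<cdot> f"
      using idem_mult[OF idem_prod[OF e f]] by (simp add: s)
    show "f \<cdot> e \<cdot> (e \<cdot> f) \<cdot> (f \<cdot> e) = f \<cdot> e"
      using idem_mult[OF idem_prod[OF f e]] by (simp add: s)
  qed (simp_all add: s)
  with sinv_idem[OF idem_prod[OF e f]] show ?thesis by simp
qed

lemma dom_idem: "a \<in> carrier S \<Longrightarrow> a\<dagger> \<cdot> a \<in> idempotents S"
  and ran_idem: "a \<in> carrier S \<Longrightarrow> a \<cdot> a\<dagger> \<in> idempotents S"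
  using sinv_props[of a] by (auto simp: idempotents_def closed mult_assoc[symmetric])

lemma idem_left_commute:
  assumes "e \<in> idempotents S" "f \<in> idempotents S" "a \<in> carrier S"
  shows "e \<cdot> (f \<cdot> a) = f \<cdot> (e \<cdot> a)"
  using assms idem_commute[of e f] mult_assoc[of e f a] mult_assoc[of f e a] by (simp add: idem_closed)

lemma sinv_left:
  assumes "a \<in> carrier S" "x \<in> carrier S"
  shows "a \<cdot> (a\<dagger> \<cdot> (a \<cdot> x)) = a \<cdot> x" "a\<dagger> \<cdot> (a \<cdot> (a\<dagger> \<cdot> x)) = a\<dagger> \<cdot> x"
  using assms sinv_props[OF assms(1)] by (simp_all add: closed mult_assoc[symmetric])

lemma sinv_mult:
  assumes [simp]: "a \<in> carrier S" "b \<in> carrier S"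
  shows "(a \<cdot> b)\<dagger> = b\<dagger> \<cdot> a\<dagger>"
proof (rule sinv_equality)
  note [simp] = closed mult_assoc sinv_left
  have 1: "b \<cdot> (b\<dagger> \<cdot> (a\<dagger> \<cdot> (a \<cdot> x))) = a\<dagger> \<cdot> (a \<cdot> (b \<cdot> (b\<dagger> \<cdot> x)))" if "x \<in> carrier S" for x
    using idem_left_commute[of "b \<cdot> b\<dagger>" "a\<dagger> \<cdot> a" x] that by (simp add: dom_idem ran_idem)
  show "a \<cdot> b \<cdot> (b\<dagger> \<cdot> a\<dagger>) \<cdot> (a \<cdot> b) = a \<cdot> b"
    using sinv_props(2)[of b] by (simp add: 1)
  show "b\<dagger> \<cdot> a\<dagger> \<cdot> (a \<cdot> b) \<cdot> (b\<dagger> \<cdot> a\<dagger>) = b\<dagger> \<cdot> a\<dagger>"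
    using sinv_props(3)[of a] by (simp add: 1[symmetric])
qed (simp_all add: closed)

text \<open>
  The natural order, with membership of both sides in the carrier built in, so that facts about it
  carry no separate carrier hypotheses.
\<close>
definition below (infix "\<preceq>" 50) where
  "a \<preceq> b \<longleftrightarrow> a \<in> carrier S \<and> b \<in> carrier S \<and> a = b \<cdot> a\<dagger> \<cdot> a"

lemma below_closed: "a \<preceq> b \<Longrightarrow> a \<in> carrier S" "a \<preceq> b \<Longrightarrow> b \<in> carrier S"
  by (simp_all add: below_def)

lemma below_dom: "a \<preceq> b \<Longrightarrow> b \<cdot> (a\<dagger> \<cdot> a) = a"
  by (metis below_def closed(2) mult_assoc)

lemma mult_idem_below:
  assumes [simp]: "b \<in> carrier S" and e: "e \<in> idempotents S"
  shows "b \<cdot> e \<preceq> b"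
proof -
  note [simp] = closed idem_closed mult_assoc sinv_left e sinv_mult sinv_idem idem_left_mult idem_mult
  have "e \<cdot> (b\<dagger> \<cdot> (b \<cdot> e)) = b\<dagger> \<cdot> (b \<cdot> e)"
    using idem_left_commute[OF e dom_idem[of b], of e] by simp
  then show ?thesis by (simp add: below_def)
qed

lemma below_iff_right: "a \<preceq> b \<longleftrightarrow> b \<in> carrier S \<and> (\<exists>e\<in>idempotents S. a = b \<cdot> e)"
  by (metis below_closed below_dom dom_idem mult_idem_below)

text \<open>
  Restricting \<open>b\<close> on the right to \<open>e\<close> is restricting it on the left to the conjugate \<open>b \<cdot> e \<cdot> b\<dagger>\<close>, and
  conversely.
\<close>
lemma below_iff_left: "a \<preceq> b \<longleftrightarrow> b \<in> carrier S \<and> (\<exists>e\<in>idempotents S. a = e \<cdot> b)"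
proof -
  note [simp] = closed mult_assoc sinv_left idem_left_mult idem_mult
  have "\<exists>f\<in>idempotents S. b \<cdot> e = f \<cdot> b" if [simp]: "b \<in> carrier S" and e [simp]: "e \<in> idempotents S" for e
  proof
    have [simp]: "e \<in> carrier S" by (rule idem_closed[OF e])
    have 1: "e \<cdot> (b\<dagger> \<cdot> (b \<cdot> x)) = b\<dagger> \<cdot> (b \<cdot> (e \<cdot> x))" if "x \<in> carrier S" for x
      using idem_left_commute[OF e dom_idem[of b], of x] that by simp
    show "b \<cdot> e \<cdot> b\<dagger> \<in> idempotents S" by (rule idemI) (simp_all add: 1)
    show "b \<cdot> e = b \<cdot> e \<cdot> b\<dagger> \<cdot> b"
      using idem_commute[OF e dom_idem[of b]] by simp
  qed
  moreover have "\<exists>f\<in>idempotents S. e \<cdot> b = b \<cdot> f" if [simp]: "b \<in> carrier S" and e [simp]: "e \<in> idempotents S" for e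
  proof
    have [simp]: "e \<in> carrier S" by (rule idem_closed[OF e])
    have 1: "e \<cdot> (b \<cdot> (b\<dagger> \<cdot> x)) = b \<cdot> (b\<dagger> \<cdot> (e \<cdot> x))" if "x \<in> carrier S" for x
      using idem_left_commute[OF e ran_idem[of b], of x] that by simp
    show "b\<dagger> \<cdot> e \<cdot> b \<in> idempotents S" by (rule idemI) (simp_all add: 1)
    show "e \<cdot> b = b \<cdot> (b\<dagger> \<cdot> e \<cdot> b)"
      using 1[of b] sinv_props(2)[of b] by simp
  qed
  ultimately show ?thesis unfolding below_iff_right by metis
qed

lemma below_refl: "a \<in> carrier S \<Longrightarrow> a \<preceq> a"
  by (simp add: below_def sinv_props)

lemma below_trans [trans]:
  assumes "a \<preceq> b" "b \<preceq> c" shows "a \<preceq> c"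
proof -
  obtain e f where "e \<in> idempotents S" "f \<in> idempotents S" "c \<in> carrier S" "b = c \<cdot> f" "a = b \<cdot> e"
    using assms unfolding below_iff_right by blast
  moreover from this have "a = c \<cdot> (f \<cdot> e)" by (simp add: mult_assoc idem_closed)
  ultimately show ?thesis using below_iff_right idem_prod by blast
qed

lemma below_antisym:
  assumes "a \<preceq> b" "b \<preceq> a" shows "a = b"
proof -
  obtain e f where ef: "e \<in> idempotents S" "f \<in> idempotents S" "b \<in> carrier S" "a = b \<cdot> e" "b = a \<cdot> f"
    using assms unfolding below_iff_right by blast
  note c = idem_closed[OF ef(1)] idem_closed[OF ef(2)] ef(3)
  have b: "b = b \<cdot> (e \<cdot> f)"
    using ef(5) unfolding ef(4) mult_assoc[OF c(3,1,2)] .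
  have "f \<cdot> e = e \<cdot> f" by (rule idem_commute[OF ef(2,1)])
  then have "(e \<cdot> f) \<cdot> e = e \<cdot> f"
    using c idem_left_mult[OF ef(1) c(2)] by (simp add: mult_assoc)
  then have "b \<cdot> (e \<cdot> f) \<cdot> e = b \<cdot> (e \<cdot> f)"
    using c by (simp add: mult_assoc mult_closed)
  then have "b \<cdot> e = b" unfolding b[symmetric] .
  with ef(4) show ?thesis by (rule trans)
qed

lemma below_mult_left:
  assumes "a \<preceq> b" and c: "c \<in> carrier S" shows "c \<cdot> a \<preceq> c \<cdot> b"
proof -
  obtain e where "e \<in> idempotents S" "b \<in> carrier S" "a = b \<cdot> e"
    using assms unfolding below_iff_right by blast
  then have "c \<cdot> a = c \<cdot> b \<cdot> e" "e \<in> idempotents S" "c \<cdot> b \<in> carrier S"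
    using c by (simp_all add: mult_assoc mult_closed idem_closed)
  then show ?thesis unfolding below_iff_right by blast
qed

lemma below_mult_right:
  assumes "a \<preceq> b" and c: "c \<in> carrier S" shows "a \<cdot> c \<preceq> b \<cdot> c"
proof -
  obtain e where "e \<in> idempotents S" "b \<in> carrier S" "a = e \<cdot> b"
    using assms unfolding below_iff_left by blast
  then have "a \<cdot> c = e \<cdot> (b \<cdot> c)" "e \<in> idempotents S" "b \<cdot> c \<in> carrier S"
    using c by (simp_all add: mult_assoc mult_closed idem_closed)
  then show ?thesis unfolding below_iff_left by blast
qed

lemma below_sinv:
  assumes "a \<preceq> b" shows "a\<dagger> \<preceq> b\<dagger>"
proof -
  obtain e where "e \<in> idempotents S" "b \<in> carrier S" "a = e \<cdot> b"
    using assms unfolding below_iff_left by blast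
  then have "a\<dagger> = b\<dagger> \<cdot> e" "e \<in> idempotents S" "b\<dagger> \<in> carrier S"
    by (simp_all add: sinv_mult sinv_idem closed idem_closed)
  then show ?thesis unfolding below_iff_right by blast
qed

lemma below_mult: "a \<preceq> b \<Longrightarrow> c \<preceq> d \<Longrightarrow> a \<cdot> c \<preceq> b \<cdot> d"
  by (rule below_trans[OF below_mult_right below_mult_left]) (simp_all add: below_closed)

lemma below_idem: "f \<preceq> e \<Longrightarrow> e \<in> idempotents S \<Longrightarrow> f \<in> idempotents S"
  unfolding below_iff_right using idem_prod by blast

lemma below_idem_mult:
  assumes "f \<preceq> e" "e \<in> idempotents S" shows "e \<cdot> f = f"
  using below_dom[OF assms(1)] below_idem[OF assms] by (simp add: sinv_idem idem_mult)

lemma below_ran: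
  assumes "a \<preceq> b" shows "(a \<cdot> a\<dagger>) \<cdot> b = a"
proof -
  obtain e where e: "e \<in> idempotents S" and b: "b \<in> carrier S" and a: "a = e \<cdot> b"
    using assms unfolding below_iff_left by blast
  note s = e b mult_assoc closed idem_closed sinv_mult sinv_idem idem_left_mult
  have "a \<cdot> a\<dagger> \<cdot> b = e \<cdot> (b \<cdot> b\<dagger>) \<cdot> (e \<cdot> b)"
    by (simp add: a s)
  also have "\<dots> = e \<cdot> (e \<cdot> (b \<cdot> b\<dagger> \<cdot> b))"
    using idem_left_commute[OF e ran_idem[OF b] b] by (simp add: s)
  also have "\<dots> = a"
    using sinv_props(2)[OF b] by (simp add: a idem_left_mult e b)
  finally show ?thesis .
qed

text \<open>
  These two facts are why the elements below a fixed one form a local bisection.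
\<close>
lemma below_eq_dom: "a \<preceq> c \<Longrightarrow> b \<preceq> c \<Longrightarrow> a\<dagger> \<cdot> a = b\<dagger> \<cdot> b \<Longrightarrow> a = b"
  by (metis below_dom)

lemma below_eq_ran: "a \<preceq> c \<Longrightarrow> b \<preceq> c \<Longrightarrow> a \<cdot> a\<dagger> = b \<cdot> b\<dagger> \<Longrightarrow> a = b"
  by (metis below_ran)

lemma natural_order_below:
  "a \<in> carrier S \<Longrightarrow> b \<in> carrier S \<Longrightarrow> a \<sqsubseteq>\<^bsub>natural_order S\<^esub> b \<longleftrightarrow> a \<preceq> b"
  by (simp add: natural_order_def below_def)

lemma carrier_natural_order: "carrier (natural_order S) = carrier S"
  by (simp add: natural_order_def)

lemma is_lub_below:
  assumes "a \<in> carrier S" "b \<in> carrier S"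
  shows "is_lub (natural_order S) j {a, b} \<longleftrightarrow>
    a \<preceq> j \<and> b \<preceq> j \<and> (\<forall>u. a \<preceq> u \<longrightarrow> b \<preceq> u \<longrightarrow> j \<preceq> u)"
proof -
  have "Upper (natural_order S) {a, b} = {u. a \<preceq> u \<and> b \<preceq> u}"
    unfolding Upper_def using assms
    by (auto simp: carrier_natural_order natural_order_below dest: below_closed)
  then have "is_lub (natural_order S) j {a, b} \<longleftrightarrow>
      a \<preceq> j \<and> b \<preceq> j \<and> (\<forall>u. a \<preceq> u \<longrightarrow> b \<preceq> u \<longrightarrow> j \<sqsubseteq>\<^bsub>natural_order S\<^esub> u)"
    using below_closed(2)[of a] by (simp add: least_def carrier_natural_order subset_iff imp_conjL)
  moreover have "j \<sqsubseteq>\<^bsub>natural_order S\<^esub> u \<longleftrightarrow> j \<preceq> u" if "a \<preceq> j" "a \<preceq> u" for u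
    using natural_order_below[of j u] below_closed(2) that by blast
  ultimately show ?thesis by blast
qed

lemma dom_mult:
  assumes "a \<in> carrier S" "b \<in> carrier S" "a\<dagger> \<cdot> a = b \<cdot> b\<dagger>"
  shows "(a \<cdot> b)\<dagger> \<cdot> (a \<cdot> b) = b\<dagger> \<cdot> b"
proof -
  have "(a \<cdot> b)\<dagger> \<cdot> (a \<cdot> b) = b\<dagger> \<cdot> ((a\<dagger> \<cdot> a) \<cdot> b)"
    using assms(1,2) by (simp add: sinv_mult mult_assoc closed)
  also have "\<dots> = b\<dagger> \<cdot> b"
    unfolding assms(3) using assms(2) by (simp add: sinv_props)
  finally show ?thesis .
qed

lemma ran_mult:
  assumes "a \<in> carrier S" "b \<in> carrier S" "a\<dagger> \<cdot> a = b \<cdot> b\<dagger>"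
  shows "(a \<cdot> b) \<cdot> (a \<cdot> b)\<dagger> = a \<cdot> a\<dagger>"
proof -
  have "(a \<cdot> b) \<cdot> (a \<cdot> b)\<dagger> = a \<cdot> ((b \<cdot> b\<dagger>) \<cdot> a\<dagger>)"
    using assms(1,2) by (simp add: sinv_mult mult_assoc closed)
  also have "\<dots> = a \<cdot> a\<dagger>"
    unfolding assms(3)[symmetric] using assms(1) by (simp add: sinv_props)
  finally show ?thesis .
qed

lemma idems_compatible:
  assumes "e \<in> idempotents S" "f \<in> idempotents S"
  shows "compatible S e f"
  using assms by (simp add: compatible_def sinv_idem idem_prod)

end

section \<open>The groupoid of atoms\<close>

context distributive_inverse_semigroup
begin

definition zero ("\<zero>") where
  "\<zero> = (SOME z. z \<in> carrier S \<and> (\<forall>a\<in>carrier S. z \<cdot> a = z \<and> a \<cdot> z = z))"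

lemma zero_props:
  shows "\<zero> \<in> carrier S" "a \<in> carrier S \<Longrightarrow> \<zero> \<cdot> a = \<zero>" "a \<in> carrier S \<Longrightarrow> a \<cdot> \<zero> = \<zero>"
proof -
  have "\<exists>z. z \<in> carrier S \<and> (\<forall>a\<in>carrier S. z \<cdot> a = z \<and> a \<cdot> z = z)"
    using zero_exists by blast
  from someI_ex[OF this] show "\<zero> \<in> carrier S" "a \<in> carrier S \<Longrightarrow> \<zero> \<cdot> a = \<zero>"
      "a \<in> carrier S \<Longrightarrow> a \<cdot> \<zero> = \<zero>"
    unfolding zero_def by blast+
qed

lemma zero_idem: "\<zero> \<in> idempotents S"
  by (rule idemI) (simp_all add: zero_props)

lemma zero_below: "a \<in> carrier S \<Longrightarrow> \<zero> \<preceq> a"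
  unfolding below_iff_right using zero_idem zero_props(3) by metis

lemma below_zero: "a \<preceq> \<zero> \<Longrightarrow> a = \<zero>"
  using below_antisym zero_below below_closed by blast

lemma dom_zero_iff: "a \<in> carrier S \<Longrightarrow> a\<dagger> \<cdot> a = \<zero> \<longleftrightarrow> a = \<zero>"
  by (metis mult_assoc sinv_props(1,2) zero_props(3))

lemma ran_zero_iff: "a \<in> carrier S \<Longrightarrow> a \<cdot> a\<dagger> = \<zero> \<longleftrightarrow> a = \<zero>"
  by (metis sinv_props(1,2) zero_props(2))

definition atom where
  "atom x \<longleftrightarrow> x \<in> carrier S \<and> x \<noteq> \<zero> \<and> (\<forall>y. y \<preceq> x \<longrightarrow> y = \<zero> \<or> y = x)"

lemma atom_closed: "atom x \<Longrightarrow> x \<in> carrier S"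
  by (simp add: atom_def)

lemma atom_nonzero: "atom x \<Longrightarrow> x \<noteq> \<zero>"
  by (simp add: atom_def)

lemma below_atom: "atom x \<Longrightarrow> y \<preceq> x \<Longrightarrow> y \<noteq> \<zero> \<Longrightarrow> y = x"
  by (auto simp: atom_def)

lemma below_dom_mono: "a \<preceq> b \<Longrightarrow> a\<dagger> \<cdot> a \<preceq> b\<dagger> \<cdot> b"
  by (simp add: below_mult below_sinv)

text \<open>
  The maps \<open>y \<mapsto> y\<dagger> \<cdot> y\<close> and \<open>f \<mapsto> x \<cdot> f\<close> are mutually inverse between the elements below \<open>x\<close> and the
  idempotents below \<open>x\<dagger> \<cdot> x\<close>.
\<close>
lemma atom_dom_iff:
  assumes x: "x \<in> carrier S"
  shows "atom (x\<dagger> \<cdot> x) \<longleftrightarrow> atom x"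
proof
  assume a: "atom (x\<dagger> \<cdot> x)"
  have "y = \<zero> \<or> y = x" if "y \<preceq> x" for y
  proof (rule disjCI)
    assume "y \<noteq> x"
    with below_dom[OF that] sinv_props[OF x] x have "y\<dagger> \<cdot> y \<noteq> x\<dagger> \<cdot> x"
      by (metis mult_assoc)
    then have "y\<dagger> \<cdot> y = \<zero>"
      using below_atom[OF a below_dom_mono[OF that]] by blast
    then show "y = \<zero>" using dom_zero_iff below_closed that by blast
  qed
  then show "atom x" using x a atom_nonzero dom_zero_iff unfolding atom_def by blast
next
  assume a: "atom x"
  have "f = \<zero> \<or> f = x\<dagger> \<cdot> x" if f: "f \<preceq> x\<dagger> \<cdot> x" for f
  proof -
    have fi: "f \<in> idempotents S" using below_idem[OF f] dom_idem[OF x] by blast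
    have 1: "x\<dagger> \<cdot> (x \<cdot> f) = f"
      using below_idem_mult[OF f dom_idem[OF x]] x fi by (simp add: mult_assoc closed idem_closed)
    have "x \<cdot> f = \<zero> \<or> x \<cdot> f = x"
      using below_atom[OF a mult_idem_below[OF x fi]] by blast
    with 1 show ?thesis using zero_props(3) closed x by metis
  qed
  then show "atom (x\<dagger> \<cdot> x)"
    using a x dom_zero_iff closed unfolding atom_def by blast
qed

lemma atom_sinv:
  assumes "atom x" shows "atom (x\<dagger>)"
  unfolding atom_def
proof (intro conjI allI impI)
  have x: "x \<in> carrier S" by (rule atom_closed[OF assms])
  show "x\<dagger> \<in> carrier S" using x by (rule closed)
  have z: "\<zero>\<dagger> = \<zero>" by (rule sinv_idem[OF zero_idem])
  then show "x\<dagger> \<noteq> \<zero>" using atom_nonzero[OF assms] sinv_sinv[OF x] by metis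
  fix y assume y: "y \<preceq> x\<dagger>"
  then have "y\<dagger> \<preceq> x" using below_sinv[OF y] sinv_sinv[OF x] by simp
  then have "y\<dagger> = \<zero> \<or> y\<dagger> = x" using below_atom[OF assms] by blast
  then show "y = \<zero> \<or> y = x\<dagger>" using sinv_sinv below_closed(1)[OF y] z by metis
qed

lemma atom_ran_iff:
  assumes x: "x \<in> carrier S"
  shows "atom (x \<cdot> x\<dagger>) \<longleftrightarrow> atom x"
  using atom_dom_iff[OF closed(2)[OF x]] atom_sinv[of x] atom_sinv[of "x\<dagger>"] sinv_sinv[OF x] by auto

definition atom_groupoid :: "'a groupoid" where
  "atom_groupoid = \<lparr>arrows = {x. atom x}, gdom = (\<lambda>x. x\<dagger> \<cdot> x), gran = (\<lambda>x. x \<cdot> x\<dagger>), gcomp = (\<cdot>)\<rparr>"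

lemma atom_mult:
  assumes "atom a" "atom b" "a\<dagger> \<cdot> a = b \<cdot> b\<dagger>"
  shows "atom (a \<cdot> b)"
  using assms atom_dom_iff[of "a \<cdot> b"] atom_dom_iff[of b] dom_mult[of a b]
  by (simp add: atom_closed closed)

lemma dom_ran_idem:
  assumes "e \<in> idempotents S" shows "e\<dagger> \<cdot> e = e" "e \<cdot> e\<dagger> = e"
  using assms by (simp_all add: sinv_idem idem_mult)

lemma groupoid_atoms: "groupoid atom_groupoid"
proof -
  have "a \<cdot> (a\<dagger> \<cdot> a) = a" if "atom a" for a
    using sinv_props[OF atom_closed[OF that]] atom_closed[OF that] mult_assoc by metis
  moreover have "\<exists>b. atom b \<and> b\<dagger> \<cdot> b = a \<cdot> a\<dagger> \<and> b \<cdot> b\<dagger> = a\<dagger> \<cdot> a \<and>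
      b \<cdot> a = a\<dagger> \<cdot> a \<and> a \<cdot> b = a \<cdot> a\<dagger>" if "atom a" for a
    using atom_sinv[OF that] sinv_sinv[OF atom_closed[OF that]] by metis
  ultimately show ?thesis
    by unfold_locales
      (simp_all add: atom_groupoid_def atom_closed atom_dom_iff atom_ran_iff sinv_props
         dom_ran_idem dom_idem ran_idem atom_mult dom_mult ran_mult,
       simp_all add: mult_assoc atom_closed)
qed

definition atoms_below where "atoms_below a = {x. atom x \<and> x \<preceq> a}"

lemma local_bisection_atoms_below: "local_bisection atom_groupoid (atoms_below a)"
  using below_eq_dom below_eq_ran
  by (auto simp: local_bisection_def atoms_below_def atom_groupoid_def)

text \<open>
  Given an atom \<open>z\<close> below \<open>a \<cdot> b\<close>, restrict \<open>b\<close> to the source of \<open>z\<close> to get \<open>y\<close>, then restrict \<open>a\<close> to the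
  target of \<open>y\<close> to get \<open>x\<close>. Then \<open>x \<cdot> y = z\<close>, and neither factor is zero. The source of \<open>y\<close> lies below that
  of \<open>z\<close>, so \<open>y\<close> is an atom; the source of \<open>x\<close> lies below the target of \<open>y\<close>, so \<open>x\<close> is an atom and the
  pair is composable.
\<close>
lemma atoms_below_mult:
  assumes a: "a \<in> carrier S" and b: "b \<in> carrier S"
  shows "atoms_below (a \<cdot> b) =
    {x \<cdot> y |x y. x \<in> atoms_below a \<and> y \<in> atoms_below b \<and> x\<dagger> \<cdot> x = y \<cdot> y\<dagger>}"
proof (intro equalityI subsetI)
  fix z assume "z \<in> {x \<cdot> y |x y. x \<in> atoms_below a \<and> y \<in> atoms_below b \<and> x\<dagger> \<cdot> x = y \<cdot> y\<dagger>}"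
  then show "z \<in> atoms_below (a \<cdot> b)"
    by (auto simp: atoms_below_def intro: atom_mult below_mult)
next
  fix z assume "z \<in> atoms_below (a \<cdot> b)"
  then have z: "atom z" "z \<preceq> a \<cdot> b" by (auto simp: atoms_below_def)
  have zc: "z \<in> carrier S" using z atom_closed by blast
  define y where "y = b \<cdot> (z\<dagger> \<cdot> z)"
  define x where "x = a \<cdot> (y \<cdot> y\<dagger>)"
  have y: "y \<preceq> b" unfolding y_def by (rule mult_idem_below[OF b dom_idem[OF zc]])
  have yc: "y \<in> carrier S" using y below_closed by blast
  have x: "x \<preceq> a" unfolding x_def by (rule mult_idem_below[OF a ran_idem[OF yc]])
  have xc: "x \<in> carrier S" using x below_closed by blast
  have "a \<cdot> y = z"
    using below_dom[OF z(2)] zc a b by (simp add: y_def mult_assoc closed)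
  moreover have "x \<cdot> y = a \<cdot> y"
    using sinv_props[OF yc] yc a by (simp add: x_def mult_assoc closed)
  ultimately have xy: "x \<cdot> y = z" "a \<cdot> y = z" by auto
  have y0: "y \<noteq> \<zero>" and x0: "x \<noteq> \<zero>"
    using xy zero_props a yc atom_nonzero[OF z(1)] by auto
  have "y \<cdot> (z\<dagger> \<cdot> z) = y"
    using idem_mult[OF dom_idem[OF zc]] b zc by (simp add: y_def mult_assoc closed)
  then have "y\<dagger> \<cdot> y \<preceq> z\<dagger> \<cdot> z"
    using mult_idem_below[OF closed(1)[OF closed(2)[OF yc] yc] dom_idem[OF zc]]
      idem_commute[OF dom_idem[OF yc] dom_idem[OF zc]]
      mult_idem_below[OF closed(1)[OF closed(2)[OF zc] zc] dom_idem[OF yc]]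
      yc zc by (simp add: mult_assoc closed)
  then have "y\<dagger> \<cdot> y = z\<dagger> \<cdot> z"
    using below_atom z(1) atom_dom_iff zc y0 dom_zero_iff yc by blast
  then have ya: "atom y" using atom_dom_iff zc yc z(1) by metis
  have "x \<cdot> (y \<cdot> y\<dagger>) = x"
    using idem_mult[OF ran_idem[OF yc]] a yc by (simp add: x_def mult_assoc closed)
  then have "x\<dagger> \<cdot> x \<preceq> y \<cdot> y\<dagger>"
    using idem_commute[OF dom_idem[OF xc] ran_idem[OF yc]]
      mult_idem_below[OF closed(1)[OF yc closed(2)[OF yc]] dom_idem[OF xc]]
      yc xc by (simp add: mult_assoc closed)
  then have xy': "x\<dagger> \<cdot> x = y \<cdot> y\<dagger>"
    using below_atom ya atom_ran_iff yc x0 dom_zero_iff xc by blast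
  then have "atom x" using atom_dom_iff atom_ran_iff ya yc xc by metis
  with xy xy' ya x y show "z \<in> {x \<cdot> y |x y. x \<in> atoms_below a \<and> y \<in> atoms_below b \<and> x\<dagger> \<cdot> x = y \<cdot> y\<dagger>}"
    by (force simp: atoms_below_def)
qed

lemma lub_exists:
  assumes "a \<in> carrier S" "b \<in> carrier S" "compatible S a b"
  obtains j where "a \<preceq> j" "b \<preceq> j" "\<And>u. a \<preceq> u \<Longrightarrow> b \<preceq> u \<Longrightarrow> j \<preceq> u"
  using join_exists[OF assms] is_lub_below[OF assms(1,2)] by blast

lemma lub_mult_left:
  assumes "a \<in> carrier S" "b \<in> carrier S" "compatible S a b" "c \<in> carrier S"
    and "a \<preceq> j" "b \<preceq> j" "\<And>u. a \<preceq> u \<Longrightarrow> b \<preceq> u \<Longrightarrow> j \<preceq> u"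
    and "c \<cdot> a \<preceq> v" "c \<cdot> b \<preceq> v"
  shows "c \<cdot> j \<preceq> v"
proof -
  have "is_lub (natural_order S) j {a, b}"
    unfolding is_lub_below[OF assms(1,2)] using assms(5-7) by blast
  then have "is_lub (natural_order S) (c \<cdot> j) {c \<cdot> a, c \<cdot> b}"
    by (rule mult_join_distrib_left[OF assms(1,2,4,3)])
  then show ?thesis
    unfolding is_lub_below[OF mult_closed[OF assms(4,1)] mult_closed[OF assms(4,2)]]
    using assms(8,9) by blast
qed

lemma lub_mult_right:
  assumes "a \<in> carrier S" "b \<in> carrier S" "compatible S a b" "c \<in> carrier S"
    and "a \<preceq> j" "b \<preceq> j" "\<And>u. a \<preceq> u \<Longrightarrow> b \<preceq> u \<Longrightarrow> j \<preceq> u"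
    and "a \<cdot> c \<preceq> v" "b \<cdot> c \<preceq> v"
  shows "j \<cdot> c \<preceq> v"
proof -
  have "is_lub (natural_order S) j {a, b}"
    unfolding is_lub_below[OF assms(1,2)] using assms(5-7) by blast
  then have "is_lub (natural_order S) (j \<cdot> c) {a \<cdot> c, b \<cdot> c}"
    by (rule mult_join_distrib_right[OF assms(1,2,4,3)])
  then show ?thesis
    unfolding is_lub_below[OF mult_closed[OF assms(1,4)] mult_closed[OF assms(2,4)]]
    using assms(8,9) by blast
qed

text \<open>
  The bisection condition forces \<open>x\<close> to be orthogonal to \<open>a\<close>: if \<open>x\<close> and \<open>a\<close> overlapped at the source or
  at the target of \<open>x\<close>, the restriction of \<open>a\<close> there would be an atom below \<open>a\<close> sharing that end with \<open>x\<close>,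
  hence equal to \<open>x\<close>, which is not below \<open>a\<close>. Orthogonal elements are compatible, and their join \<open>j\<close> is the required element:
  multiplying \<open>j\<close> by the source of an atom \<open>w\<close> below it gives \<open>w\<close>, and distributivity leaves \<open>w\<close> no
  place but under \<open>x\<close> or under \<open>a\<close>.
\<close>
lemma atoms_below_insert:
  assumes a: "a \<in> carrier S" and x: "atom x"
    and lb: "local_bisection atom_groupoid (insert x (atoms_below a))" and xa: "x \<notin> atoms_below a"
  shows "\<exists>j\<in>carrier S. atoms_below j = insert x (atoms_below a)"
proof -
  have xc: "x \<in> carrier S" by (rule atom_closed[OF x])
  have z: "\<zero>\<dagger> = \<zero>" by (rule sinv_idem[OF zero_idem])
  have 1: "x \<cdot> x\<dagger> \<cdot> a = \<zero>"
  proof (rule ccontr)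
    define y where "y = x \<cdot> x\<dagger> \<cdot> a"
    assume "x \<cdot> x\<dagger> \<cdot> a \<noteq> \<zero>"
    then have y0: "y \<noteq> \<zero>" by (simp add: y_def)
    have ya: "y \<preceq> a" unfolding y_def below_iff_left using a ran_idem[OF xc] by blast
    have yc: "y \<in> carrier S" using ya below_closed by blast
    have "y \<cdot> y\<dagger> = x \<cdot> x\<dagger> \<cdot> (a \<cdot> y\<dagger>)" using a xc yc by (simp add: y_def mult_assoc closed)
    also have "\<dots> \<preceq> x \<cdot> x\<dagger>"
    proof -
      have "a \<cdot> y\<dagger> \<preceq> a \<cdot> a\<dagger>" by (rule below_mult_left[OF below_sinv[OF ya] a])
      then have "a \<cdot> y\<dagger> \<in> idempotents S" using below_idem ran_idem a by blast
      then show ?thesis using mult_idem_below xc closed by blast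
    qed
    finally have eq: "y \<cdot> y\<dagger> = x \<cdot> x\<dagger>"
      using below_atom atom_ran_iff x xc y0 ran_zero_iff yc by blast
    have "atom y" using atom_ran_iff[OF xc] atom_ran_iff[OF yc] x eq by simp
    then have "y \<in> atoms_below a" using ya by (simp add: atoms_below_def)
    moreover from this have "y = x"
      using lb eq unfolding local_bisection_def atom_groupoid_def by auto
    ultimately show False using xa by simp
  qed
  have 2: "a \<cdot> (x\<dagger> \<cdot> x) = \<zero>"
  proof (rule ccontr)
    define y where "y = a \<cdot> (x\<dagger> \<cdot> x)"
    assume "a \<cdot> (x\<dagger> \<cdot> x) \<noteq> \<zero>"
    then have y0: "y \<noteq> \<zero>" by (simp add: y_def)
    have ya: "y \<preceq> a" unfolding y_def by (rule mult_idem_below[OF a dom_idem[OF xc]])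
    have yc: "y \<in> carrier S" using ya below_closed by blast
    have "y\<dagger> \<cdot> y = (y\<dagger> \<cdot> a) \<cdot> (x\<dagger> \<cdot> x)" using a xc yc by (simp add: y_def mult_assoc closed)
    also have "\<dots> \<preceq> x\<dagger> \<cdot> x"
    proof -
      have "y\<dagger> \<cdot> a \<preceq> a\<dagger> \<cdot> a" by (rule below_mult_right[OF below_sinv[OF ya] a])
      then have "y\<dagger> \<cdot> a \<in> idempotents S" using below_idem dom_idem a by blast
      then show ?thesis unfolding below_iff_left using xc closed by blast
    qed
    finally have eq: "y\<dagger> \<cdot> y = x\<dagger> \<cdot> x"
      using below_atom atom_dom_iff x xc y0 dom_zero_iff yc by blast
    have "atom y" using atom_dom_iff[OF xc] atom_dom_iff[OF yc] x eq by simp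
    then have "y \<in> atoms_below a" using ya by (simp add: atoms_below_def)
    moreover from this have "y = x"
      using lb eq unfolding local_bisection_def atom_groupoid_def by auto
    ultimately show False using xa by simp
  qed
  have "x\<dagger> \<cdot> a = \<zero>"
    using arg_cong[OF 1, of "\<lambda>t. x\<dagger> \<cdot> t"] sinv_left(2)[OF xc a] a xc
    by (simp add: mult_assoc closed zero_props)
  moreover have "a \<cdot> x\<dagger> = \<zero>"
    using arg_cong[OF 2, of "\<lambda>t. t \<cdot> x\<dagger>"] sinv_props(3)[OF xc] a xc
    by (simp add: mult_assoc closed zero_props)
  then have "(a \<cdot> x\<dagger>)\<dagger> = \<zero>" using z by simp
  then have "x \<cdot> a\<dagger> = \<zero>" using a xc by (simp add: sinv_mult closed sinv_sinv)
  ultimately have comp: "compatible S x a" by (simp add: compatible_def zero_idem)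
  obtain j where j: "x \<preceq> j" "a \<preceq> j" "\<And>u. x \<preceq> u \<Longrightarrow> a \<preceq> u \<Longrightarrow> j \<preceq> u"
    using lub_exists[OF xc a comp] by blast
  have jc: "j \<in> carrier S" using j(1) below_closed by blast
  have "w = x \<or> w \<preceq> a" if w: "atom w" "w \<preceq> j" for w
  proof (rule ccontr)
    assume n: "\<not> (w = x \<or> w \<preceq> a)"
    let ?d = "w\<dagger> \<cdot> w"
    have wc: "w \<in> carrier S" by (rule atom_closed[OF w(1)])
    have d: "?d \<in> idempotents S" "?d \<in> carrier S" using dom_idem wc closed by blast+
    have jd: "j \<cdot> ?d = w" by (rule below_dom[OF w(2)])
    have *: "c \<cdot> ?d = \<zero> \<or> w \<preceq> c" if "c \<preceq> j" for c
    proof -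
      have "c \<cdot> ?d \<preceq> w" using below_mult_right[OF that d(2)] jd by simp
      moreover have "c \<cdot> ?d \<preceq> c" using mult_idem_below d(1) below_closed that by blast
      ultimately show ?thesis using below_atom[OF w(1)] by metis
    qed
    have "\<not> w \<preceq> x" using below_atom[OF x] atom_nonzero w(1) n by blast
    then have "x \<cdot> ?d = \<zero>" "a \<cdot> ?d = \<zero>" using * j n by blast+
    then have "j \<cdot> ?d \<preceq> \<zero>"
      using lub_mult_right[OF xc a comp d(2) j] below_refl zero_props(1) by simp
    then have "w = \<zero>" unfolding jd by (rule below_zero)
    then show False using atom_nonzero[OF w(1)] by simp
  qed
  then have "atoms_below j = insert x (atoms_below a)"
    using j(1) x below_trans[OF _ j(2)] unfolding atoms_below_def by blast
  then show ?thesis using jc by blast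
qed

lemma atoms_below_zero: "atoms_below \<zero> = {}"
  unfolding atoms_below_def using below_zero atom_nonzero by blast

lemma atoms_below_surj:
  assumes "finite A" "local_bisection atom_groupoid A"
  shows "\<exists>a\<in>carrier S. atoms_below a = A"
  using assms
proof (induction A rule: finite_induct)
  case empty
  show ?case using atoms_below_zero zero_props(1) by blast
next
  case (insert x A)
  then have "local_bisection atom_groupoid A" by (auto simp: local_bisection_def)
  then obtain a where "a \<in> carrier S" "atoms_below a = A" using insert.IH by blast
  moreover have "atom x" using insert.prems by (auto simp: local_bisection_def atom_groupoid_def)
  ultimately show ?case using atoms_below_insert insert.prems insert.hyps by blast
qed

end

section \<open>Semisimple Boolean inverse semigroups\<close>

context boolean_inverse_semigroup
begin

text \<open>
  The complement of \<open>h\<close> in the Boolean algebra below \<open>e\<close>. That \<open>e\<close> is the join of \<open>h\<close> and \<open>h'\<close> holds for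
  all upper bounds in \<open>S\<close>, and not just for idempotent ones: \<open>h\<close> and \<open>h'\<close> are compatible, so they have a
  join in \<open>S\<close>, and it lies below \<open>e\<close>, where it can be compared with the join of the Boolean algebra.
\<close>
lemma relative_complement:
  assumes e: "e \<in> idempotents S" and h: "h \<preceq> e"
  obtains h' where "h' \<preceq> e" "h \<cdot> h' = \<zero>" "\<And>u. h \<preceq> u \<Longrightarrow> h' \<preceq> u \<Longrightarrow> e \<preceq> u"
proof -
  define P where "P = principal_ideal (idempotent_order S) e"
  have "carrier P = {x \<in> idempotents S. x = e \<cdot> x\<dagger> \<cdot> x}"
    by (simp add: P_def principal_ideal_def idempotent_order_def natural_order_def)
  also have "\<dots> = {x. x \<preceq> e}"
  proof (rule Collect_cong, rule iffI)
    fix x assume x: "x \<in> idempotents S \<and> x = e \<cdot> x\<dagger> \<cdot> x"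
    show "x \<preceq> e"
      unfolding below_def by (intro conjI conjunct2[OF x] idem_closed[OF e] idem_closed[OF conjunct1[OF x]])
  next
    fix x assume x: "x \<preceq> e"
    then show "x \<in> idempotents S \<and> x = e \<cdot> x\<dagger> \<cdot> x"
      using below_idem[OF x e] x[unfolded below_def] by iprover
  qed
  finally have carr: "carrier P = {x. x \<preceq> e}" .
  have "x \<sqsubseteq>\<^bsub>P\<^esub> y \<longleftrightarrow> x = y \<cdot> x\<dagger> \<cdot> x" for x y
    by (simp add: P_def principal_ideal_def idempotent_order_def natural_order_def)
  then have le: "x \<sqsubseteq>\<^bsub>P\<^esub> y \<longleftrightarrow> x \<preceq> y" if "x \<preceq> e" "y \<preceq> e" for x y
    using below_closed(1)[OF that(1)] below_closed(1)[OF that(2)] by (simp only: below_def simp_thms)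
  have "e \<in> carrier (idempotent_order S)" using e by (simp add: idempotent_order_def)
  then interpret P: unital_boolean_algebra P
    unfolding P_def by (rule generalized_boolean_algebra.principal_ideal_boolean[OF idempotents_boolean])
  have ee: "e \<preceq> e" using below_refl e idem_closed by blast
  obtain h' where h': "h' \<in> carrier P" "h \<sqinter>\<^bsub>P\<^esub> h' = \<bottom>\<^bsub>P\<^esub>" "h \<squnion>\<^bsub>P\<^esub> h' = \<top>\<^bsub>P\<^esub>"
    using P.complement_exists[of h] h carr by blast
  then have he: "h' \<preceq> e" using carr by simp
  have idem: "h \<in> idempotents S" "h' \<in> idempotents S" using below_idem h he e by blast+
  have z: "\<zero> \<preceq> e" using zero_below e idem_closed by blast
  note hc = idem_closed[OF idem(1)] idem_closed[OF idem(2)]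
  have hh: "h \<cdot> h' \<preceq> h" "h \<cdot> h' \<preceq> h'"
    using mult_idem_below[OF hc(1) idem(2)] mult_idem_below[OF hc(2) idem(1)]
    unfolding idem_commute[OF idem(2,1)] .
  have hhe: "h \<cdot> h' \<preceq> e" by (rule below_trans[OF hh(1) h])
  have me: "h \<sqinter>\<^bsub>P\<^esub> h' \<preceq> e" using P.meet_closed[of h h'] h he carr by simp
  have "h \<cdot> h' \<sqsubseteq>\<^bsub>P\<^esub> h \<sqinter>\<^bsub>P\<^esub> h'"
    by (rule P.meet_le) (simp_all add: carr h he hhe hh le)
  then have "h \<cdot> h' \<preceq> h \<sqinter>\<^bsub>P\<^esub> h'" using le[OF hhe me] by simp
  also have "h \<sqinter>\<^bsub>P\<^esub> h' \<preceq> \<zero>"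
  proof -
    have "\<bottom>\<^bsub>P\<^esub> \<sqsubseteq>\<^bsub>P\<^esub> \<zero>"
      using P.bottom_lower z carr by blast
    then show ?thesis using le[OF me z] unfolding h'(2) by blast
  qed
  finally have 1: "h \<cdot> h' = \<zero>" using below_zero by blast
  have te: "\<top>\<^bsub>P\<^esub> \<preceq> e" using P.top_closed carr by simp
  have "e \<sqsubseteq>\<^bsub>P\<^esub> \<top>\<^bsub>P\<^esub>"
    using P.top_higher ee carr by blast
  then have top: "e \<preceq> \<top>\<^bsub>P\<^esub>" using le[OF ee te] by simp
  have 2: "e \<preceq> u" if u: "h \<preceq> u" "h' \<preceq> u" for u
  proof -
    obtain j where j: "h \<preceq> j" "h' \<preceq> j" "\<And>u. h \<preceq> u \<Longrightarrow> h' \<preceq> u \<Longrightarrow> j \<preceq> u"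
      using lub_exists[OF hc idems_compatible[OF idem]] by blast
    have je: "j \<preceq> e" by (rule j(3)[OF h he])
    have "h \<squnion>\<^bsub>P\<^esub> h' \<sqsubseteq>\<^bsub>P\<^esub> j"
      by (rule P.join_le) (simp_all add: carr h he je j(1,2) le)
    then have "h \<squnion>\<^bsub>P\<^esub> h' \<preceq> j"
      using le[OF _ je] te unfolding h'(3) by blast
    then have "e \<preceq> j" unfolding h'(3) by (rule below_trans[OF top])
    then show ?thesis by (rule below_trans[OF _ j(3)[OF u]])
  qed
  show thesis by (rule that[OF he 1 2])
qed

text \<open>
  Induction on the size of the order ideal of \<open>a\<close>. If some \<open>c\<close> lies strictly between zero and \<open>a\<close>, let \<open>h\<close>
  be its source and \<open>h'\<close> the complement of \<open>h\<close> in the source of \<open>a\<close>. Then \<open>a \<cdot> h = c\<close> and \<open>a \<cdot> h'\<close> are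
  strictly below \<open>a\<close>, and by distributivity \<open>a\<close> is their join.
\<close>
lemma atoms_below_subset_imp_below:
  assumes "semisimple S"
  shows "a \<in> carrier S \<Longrightarrow> b \<in> carrier S \<Longrightarrow> atoms_below a \<subseteq> atoms_below b \<Longrightarrow> a \<preceq> b"
proof (induction "card {x. x \<preceq> a}" arbitrary: a rule: less_induct)
  case less
  note a = less.prems(1)
  have fin: "finite {x. x \<preceq> a}"
  proof -
    have "{x. x \<preceq> a} = {x \<in> carrier S. x \<sqsubseteq>\<^bsub>natural_order S\<^esub> a}"
      using natural_order_below a below_closed by auto
    then show ?thesis using assms a by (simp add: semisimple_def)
  qed
  have IH: "c \<preceq> b" if "c \<preceq> a" "c \<noteq> a" for c
  proof (rule less.hyps)
    have "{x. x \<preceq> c} \<subset> {x. x \<preceq> a}"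
      using that(2) below_trans[OF _ that(1)] below_antisym[OF that(1)] below_refl[OF a] by blast
    then show "card {x. x \<preceq> c} < card {x. x \<preceq> a}" by (rule psubset_card_mono[OF fin])
    show "c \<in> carrier S" using that below_closed by blast
    show "b \<in> carrier S" by (rule less.prems)
    show "atoms_below c \<subseteq> atoms_below b"
      using less.prems(3) below_trans[OF _ that(1)] by (auto simp: atoms_below_def)
  qed
  consider "a = \<zero>" | "atom a" | c where "c \<preceq> a" "c \<noteq> a" "c \<noteq> \<zero>"
    using a unfolding atom_def by blast
  then show ?case
  proof cases
    case 1
    then show ?thesis using zero_below less.prems by blast
  next
    case 2
    then have "a \<in> atoms_below a" using below_refl a by (simp add: atoms_below_def)
    then show ?thesis using less.prems(3) by (auto simp: atoms_below_def)
  next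
    case 3
    let ?e = "a\<dagger> \<cdot> a" and ?h = "c\<dagger> \<cdot> c"
    have cc: "c \<in> carrier S" using 3 below_closed by blast
    have e: "?e \<in> idempotents S" by (rule dom_idem[OF a])
    have h: "?h \<in> idempotents S" "?h \<in> carrier S" using dom_idem cc closed by blast+
    obtain h' where h': "h' \<preceq> ?e" "?h \<cdot> h' = \<zero>" "\<And>u. ?h \<preceq> u \<Longrightarrow> h' \<preceq> u \<Longrightarrow> ?e \<preceq> u"
      using relative_complement[OF e below_dom_mono[OF 3(1)]] by blast
    have hi: "h' \<in> idempotents S" "h' \<in> carrier S" using below_idem[OF h'(1) e] idem_closed by blast+
    have "a \<cdot> ?h \<preceq> b" using below_dom[OF 3(1)] IH[OF 3(1,2)] by simp
    moreover have "a \<cdot> h' \<preceq> b"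
    proof (rule IH)
      show "a \<cdot> h' \<preceq> a" by (rule mult_idem_below[OF a hi(1)])
      show "a \<cdot> h' \<noteq> a"
      proof
        assume "a \<cdot> h' = a"
        then have "c = a \<cdot> h' \<cdot> ?h" using below_dom[OF 3(1)] by simp
        also have "\<dots> = a \<cdot> (?h \<cdot> h')"
          unfolding idem_commute[OF h(1) hi(1)] by (rule mult_assoc[OF a hi(2) h(2)])
        also have "\<dots> = \<zero>" unfolding h'(2) by (rule zero_props(3)[OF a])
        finally show False using 3(3) by simp
      qed
    qed
    ultimately have "a \<cdot> ?e \<preceq> b"
      using lub_mult_left[OF h(2) hi(2) idems_compatible[OF h(1) hi(1)] a below_dom_mono[OF 3(1)] h'(1) h'(3)]
      by blast
    then show ?thesis using below_dom[OF below_refl[OF a]] by simp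
  qed
qed

theorem semisimple_imp_isomorphic_Kfin:
  assumes "semisimple S"
  shows "semigroup_isomorphic S (Kfin atom_groupoid)"
  unfolding semigroup_isomorphic_def
proof (intro exI[of _ atoms_below] conjI ballI)
  have fin: "finite (atoms_below a)" if a: "a \<in> carrier S" for a
  proof (rule finite_subset)
    show "atoms_below a \<subseteq> {x \<in> carrier S. x \<sqsubseteq>\<^bsub>natural_order S\<^esub> a}"
      using natural_order_below a atom_closed by (auto simp: atoms_below_def)
    show "finite {x \<in> carrier S. x \<sqsubseteq>\<^bsub>natural_order S\<^esub> a}"
      using assms a by (simp add: semisimple_def)
  qed
  show "bij_betw atoms_below (carrier S) (carrier (Kfin atom_groupoid))"
    unfolding bij_betw_def
  proof (intro conjI inj_onI equalityI subsetI)
    fix a b assume ab: "a \<in> carrier S" "b \<in> carrier S" and eq: "atoms_below a = atoms_below b"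
    show "a = b"
      by (rule below_antisym; rule atoms_below_subset_imp_below[OF assms]) (simp_all add: ab eq)
  next
    fix A assume "A \<in> carrier (Kfin atom_groupoid)"
    then show "A \<in> atoms_below ` carrier S"
      using atoms_below_surj[of A] by (auto simp: Kfin_def)
  next
    fix A assume "A \<in> atoms_below ` carrier S"
    then show "A \<in> carrier (Kfin atom_groupoid)"
      using fin local_bisection_atoms_below by (auto simp: Kfin_def)
  qed
  show "atoms_below (a \<cdot> b) = atoms_below a \<cdot>\<^bsub>Kfin atom_groupoid\<^esub> atoms_below b"
    if "a \<in> carrier S" "b \<in> carrier S" for a b
    using atoms_below_mult[OF that] by (simp add: Kfin_def atom_groupoid_def)
qed

end

section \<open>The generalized Boolean algebra of finite subsets\<close>

text \<open>
  The relation is required to be inclusion only on the carrier, because the natural order of a semigroup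
  of sets need not be inclusion on sets outside the semigroup.
\<close>
locale finite_subset_lattice =
  fixes L :: "('a set, 'b) gorder_scheme" and X :: "'a set"
  assumes carrier_eq: "carrier L = {A. finite A \<and> A \<subseteq> X}"
    and eq_eq: "eq L = (=)"
    and le_eq: "A \<in> carrier L \<Longrightarrow> B \<in> carrier L \<Longrightarrow> le L A B \<longleftrightarrow> A \<subseteq> B"
begin

lemma partial_order: "partial_order L"
  by unfold_locales (auto simp: eq_eq le_eq)

lemma least_iff:
  assumes "M \<subseteq> carrier L"
  shows "least L U M \<longleftrightarrow> U \<in> M \<and> (\<forall>V\<in>M. U \<subseteq> V)"
proof -
  have "U \<sqsubseteq>\<^bsub>L\<^esub> V \<longleftrightarrow> U \<subseteq> V" if "U \<in> M" "V \<in> M" for V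
    using that assms by (intro le_eq) auto
  then show ?thesis unfolding least_def using assms by blast
qed

lemma greatest_iff:
  assumes "M \<subseteq> carrier L"
  shows "greatest L U M \<longleftrightarrow> U \<in> M \<and> (\<forall>V\<in>M. V \<subseteq> U)"
proof -
  have "V \<sqsubseteq>\<^bsub>L\<^esub> U \<longleftrightarrow> V \<subseteq> U" if "U \<in> M" "V \<in> M" for V
    using that assms by (intro le_eq) auto
  then show ?thesis unfolding greatest_def using assms by blast
qed

lemma is_lub_union:
  assumes "A \<in> carrier L" "B \<in> carrier L"
  shows "least L U (Upper L {A, B}) \<longleftrightarrow> U = A \<union> B"
proof -
  have "Upper L {A, B} = {U \<in> carrier L. A \<sqsubseteq>\<^bsub>L\<^esub> U \<and> B \<sqsubseteq>\<^bsub>L\<^esub> U}"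
    unfolding Upper_def using assms by auto
  also have "\<dots> = {U \<in> carrier L. A \<union> B \<subseteq> U}"
    using assms by (simp add: le_eq cong: conj_cong)
  finally have *: "Upper L {A, B} = {U \<in> carrier L. A \<union> B \<subseteq> U}" .
  have "A \<union> B \<in> carrier L" using assms by (simp add: carrier_eq)
  then show ?thesis unfolding * least_iff[OF Collect_restrict] by blast
qed

lemma is_glb_inter:
  assumes "A \<in> carrier L" "B \<in> carrier L"
  shows "greatest L U (Lower L {A, B}) \<longleftrightarrow> U = A \<inter> B"
proof -
  have "Lower L {A, B} = {U \<in> carrier L. U \<sqsubseteq>\<^bsub>L\<^esub> A \<and> U \<sqsubseteq>\<^bsub>L\<^esub> B}"
    unfolding Lower_def using assms by auto
  also have "\<dots> = {U \<in> carrier L. U \<subseteq> A \<inter> B}"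
    using assms by (simp add: le_eq cong: conj_cong)
  finally have *: "Lower L {A, B} = {U \<in> carrier L. U \<subseteq> A \<inter> B}" .
  have "A \<inter> B \<in> carrier L" using assms by (auto simp: carrier_eq)
  then show ?thesis unfolding * greatest_iff[OF Collect_restrict] by blast
qed

lemma join_eq: "A \<in> carrier L \<Longrightarrow> B \<in> carrier L \<Longrightarrow> A \<squnion>\<^bsub>L\<^esub> B = A \<union> B"
  by (simp add: join_def sup_def is_lub_union)

lemma meet_eq: "A \<in> carrier L \<Longrightarrow> B \<in> carrier L \<Longrightarrow> A \<sqinter>\<^bsub>L\<^esub> B = A \<inter> B"
  by (simp add: meet_def inf_def is_glb_inter)

lemma least_empty: "least L U (carrier L) \<longleftrightarrow> U = {}"
  unfolding least_iff[OF subset_refl] by (auto simp: carrier_eq)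

lemma distributive: "distributive_lattice L"
proof -
  interpret partial_order L by (rule partial_order)
  interpret lattice L
    by unfold_locales (use is_lub_union is_glb_inter in blast)+
  show ?thesis
  proof
    fix A B C assume c: "A \<in> carrier L" "B \<in> carrier L" "C \<in> carrier L"
    then have "B \<union> C \<in> carrier L" "A \<inter> B \<in> carrier L" "A \<inter> C \<in> carrier L"
      by (auto simp: carrier_eq)
    with c show "A \<sqinter>\<^bsub>L\<^esub> (B \<squnion>\<^bsub>L\<^esub> C) = (A \<sqinter>\<^bsub>L\<^esub> B) \<squnion>\<^bsub>L\<^esub> (A \<sqinter>\<^bsub>L\<^esub> C)"
      by (simp add: join_eq meet_eq Int_Un_distrib)
  qed
qed

lemma unital:
  assumes "finite X" shows "unital_boolean_algebra L"
proof -
  interpret distributive_lattice L by (rule distributive)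
  have X: "greatest L U (carrier L) \<longleftrightarrow> U = X" for U
    unfolding greatest_iff[OF subset_refl] using assms by (auto simp: carrier_eq)
  have bot: "\<bottom>\<^bsub>L\<^esub> = {}" and top: "\<top>\<^bsub>L\<^esub> = X"
    by (simp_all add: bottom_def top_def least_empty X)
  show ?thesis
  proof
    show "\<exists>U. least L U (carrier L)" by (simp add: least_empty)
    show "\<exists>U. greatest L U (carrier L)" by (simp add: X)
    fix A assume A: "A \<in> carrier L"
    have "X - A \<in> carrier L" using assms by (auto simp: carrier_eq)
    moreover from A have "A \<union> (X - A) = X" by (auto simp: carrier_eq)
    ultimately show "\<exists>B\<in>carrier L. A \<sqinter>\<^bsub>L\<^esub> B = \<bottom>\<^bsub>L\<^esub> \<and> A \<squnion>\<^bsub>L\<^esub> B = \<top>\<^bsub>L\<^esub>"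
      using A by (intro bexI[of _ "X - A"]) (auto simp: join_eq meet_eq bot top)
  qed
qed

text \<open>
  The principal ideal of \<open>E\<close> is again a lattice of finite subsets, now of the finite set \<open>E\<close>.
\<close>
lemma generalized_boolean: "generalized_boolean_algebra L"
proof -
  interpret distributive_lattice L by (rule distributive)
  have "weak_partial_order_bottom L"
    by unfold_locales (simp add: least_empty)
  then show ?thesis
  proof (intro generalized_boolean_algebra.intro generalized_boolean_algebra_axioms.intro distributive)
    fix E assume E: "E \<in> carrier L"
    then have fE: "finite E" by (simp add: carrier_eq)
    have "finite_subset_lattice (principal_ideal L E) E"
    proof
      show "carrier (principal_ideal L E) = {A. finite A \<and> A \<subseteq> E}"
        using E le_eq[OF _ E] by (auto simp: principal_ideal_def carrier_eq)
    qed (simp_all add: principal_ideal_def eq_eq le_eq)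
    then show "unital_boolean_algebra (principal_ideal L E)"
      using fE by (rule finite_subset_lattice.unital)
  qed
qed

end

section \<open>The semigroup of finite local bisections\<close>

context groupoid
begin

definition ginv where
  "ginv a = (SOME b. b \<in> arrows G \<and> gdom G b = gran G a \<and> gran G b = gdom G a \<and>
         gcomp G b a = gdom G a \<and> gcomp G a b = gran G a)"

lemma ginv_props:
  assumes "a \<in> arrows G"
  shows "ginv a \<in> arrows G" "gdom G (ginv a) = gran G a" "gran G (ginv a) = gdom G a"
    "gcomp G (ginv a) a = gdom G a" "gcomp G a (ginv a) = gran G a"
proof -
  have "\<exists>b. b \<in> arrows G \<and> gdom G b = gran G a \<and> gran G b = gdom G a \<and>
         gcomp G b a = gdom G a \<and> gcomp G a b = gran G a"
    using invertible[OF assms] by blast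
  from someI_ex[OF this, folded ginv_def]
  show "ginv a \<in> arrows G" "gdom G (ginv a) = gran G a" "gran G (ginv a) = gdom G a"
    "gcomp G (ginv a) a = gdom G a" "gcomp G a (ginv a) = gran G a" by blast+
qed

lemma ginv_equality:
  assumes a: "a \<in> arrows G" and b: "b \<in> arrows G" "gdom G a = gran G b" "gcomp G a b = gran G a"
  shows "b = ginv a"
proof -
  note i = ginv_props[OF a]
  have "b = gcomp G (gdom G a) b" unfolding b(2) by (rule comp_ran[OF b(1), symmetric])
  also have "\<dots> = gcomp G (gcomp G (ginv a) a) b" unfolding i(4) ..
  also have "\<dots> = gcomp G (ginv a) (gcomp G a b)" by (rule comp_assoc[OF i(1) a b(1) i(2) b(2)])
  also have "\<dots> = gcomp G (ginv a) (gdom G (ginv a))" unfolding b(3) i(2) ..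
  also have "\<dots> = ginv a" by (rule comp_dom[OF i(1)])
  finally show ?thesis .
qed

lemma comp_ginv_identity_right:
  assumes a: "a \<in> arrows G" and b: "b \<in> arrows G"
    and d: "gdom G a = gdom G b" and e: "gcomp G a (ginv b) = gran G b"
  shows "a = b"
proof -
  note i = ginv_props[OF b]
  have da: "gdom G a = gran G (ginv b)" unfolding i(3) by (rule d)
  have "a = gcomp G a (gcomp G (ginv b) b)" unfolding i(4) d[symmetric] by (rule comp_dom[OF a, symmetric])
  also have "\<dots> = gcomp G (gcomp G a (ginv b)) b" by (rule comp_assoc[OF a i(1) b da i(2), symmetric])
  also have "\<dots> = b" unfolding e by (rule comp_ran[OF b])
  finally show ?thesis .
qed

lemma comp_ginv_identity_left:
  assumes a: "a \<in> arrows G" and b: "b \<in> arrows G"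
    and r: "gran G a = gran G b" and e: "gcomp G (ginv a) b = gdom G b"
  shows "a = b"
proof -
  note i = ginv_props[OF a]
  have ra: "gdom G (ginv a) = gran G b" unfolding i(2) by (rule r)
  have "gdom G b = gran G (gcomp G (ginv a) b)" unfolding e using dom_ran_of_dom[OF b] by simp
  also have "\<dots> = gdom G a" using dom_ran_of_comp[OF i(1) b ra] i(3) by simp
  finally have d: "gdom G b = gdom G a" .
  have "b = gcomp G (gcomp G a (ginv a)) b" unfolding i(5) r by (rule comp_ran[OF b, symmetric])
  also have "\<dots> = gcomp G a (gcomp G (ginv a) b)" by (rule comp_assoc[OF a i(1) b i(3)[symmetric] ra])
  also have "\<dots> = a" unfolding e d by (rule comp_dom[OF a])
  finally show ?thesis by (rule sym)
qed

definition setcomp (infixl "\<odot>" 70) where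
  "A \<odot> B = {gcomp G a b |a b. a \<in> A \<and> b \<in> B \<and> gdom G a = gran G b}"

lemma setcompI: "a \<in> A \<Longrightarrow> b \<in> B \<Longrightarrow> gdom G a = gran G b \<Longrightarrow> gcomp G a b \<in> A \<odot> B"
  unfolding setcomp_def by blast

lemma smul_Kfin: "A \<cdot>\<^bsub>Kfin G\<^esub> B = A \<odot> B"
  by (simp add: Kfin_def setcomp_def)

lemma carrier_Kfin: "A \<in> carrier (Kfin G) \<longleftrightarrow> finite A \<and> local_bisection G A"
  by (simp add: Kfin_def)

lemma bisection_arrow: "local_bisection G A \<Longrightarrow> a \<in> A \<Longrightarrow> a \<in> arrows G"
  by (auto simp: local_bisection_def)

lemma bisection_eqI:
  assumes "local_bisection G A" "a \<in> A" "b \<in> A"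
  shows "gdom G a = gdom G b \<Longrightarrow> a = b" "gran G a = gran G b \<Longrightarrow> a = b"
  using assms by (auto simp: local_bisection_def)

lemma setcomp_finite: "finite A \<Longrightarrow> finite B \<Longrightarrow> finite (A \<odot> B)"
proof -
  assume "finite A" "finite B"
  then have "finite ((\<lambda>(a, b). gcomp G a b) ` (A \<times> B))" by blast
  then show ?thesis by (rule rev_finite_subset) (auto simp: setcomp_def)
qed

lemma setcomp_bisection:
  assumes A: "local_bisection G A" and B: "local_bisection G B"
  shows "local_bisection G (A \<odot> B)"
proof -
  have 1: "gcomp G a b \<in> arrows G" "gdom G (gcomp G a b) = gdom G b" "gran G (gcomp G a b) = gran G a"
    if "a \<in> A" "b \<in> B" "gdom G a = gran G b" for a b
    using comp_closed[OF bisection_arrow[OF A] bisection_arrow[OF B] that(3)]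
      dom_ran_of_comp[OF bisection_arrow[OF A] bisection_arrow[OF B] that(3)] that by simp_all
  have 2: "(gdom G x = gdom G y \<longrightarrow> x = y) \<and> (gran G x = gran G y \<longrightarrow> x = y)"
    if x: "x \<in> A \<odot> B" and y: "y \<in> A \<odot> B" for x y
  proof -
    obtain a b where ab: "a \<in> A" "b \<in> B" "gdom G a = gran G b" and x: "x = gcomp G a b"
      using x unfolding setcomp_def by blast
    obtain c d where cd: "c \<in> A" "d \<in> B" "gdom G c = gran G d" and y: "y = gcomp G c d"
      using y unfolding setcomp_def by blast
    have "a = c \<longleftrightarrow> b = d"
      using bisection_eqI(1)[OF A ab(1) cd(1)] bisection_eqI(2)[OF B ab(2) cd(2)] ab(3) cd(3) by auto
    then show ?thesis
      unfolding x y 1[OF ab] 1[OF cd]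
      using bisection_eqI(2)[OF A ab(1) cd(1)] bisection_eqI(1)[OF B ab(2) cd(2)] by blast
  qed
  have "A \<odot> B \<subseteq> arrows G" unfolding setcomp_def using 1(1) by blast
  with 2 show ?thesis unfolding local_bisection_def by blast
qed

lemma Kfin_closed: "A \<in> carrier (Kfin G) \<Longrightarrow> B \<in> carrier (Kfin G) \<Longrightarrow> A \<odot> B \<in> carrier (Kfin G)"
  by (simp add: carrier_Kfin setcomp_finite setcomp_bisection)

lemma setcomp_assoc:
  assumes "A \<subseteq> arrows G" "B \<subseteq> arrows G" "C \<subseteq> arrows G"
  shows "(A \<odot> B) \<odot> C = A \<odot> (B \<odot> C)"
proof (intro equalityI subsetI)
  fix z assume "z \<in> (A \<odot> B) \<odot> C"
  then obtain a b c where z: "a \<in> A" "b \<in> B" "c \<in> C" "gdom G a = gran G b"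
    "gdom G (gcomp G a b) = gran G c" "z = gcomp G (gcomp G a b) c"
    unfolding setcomp_def by blast
  then have arr: "a \<in> arrows G" "b \<in> arrows G" "c \<in> arrows G" using assms by auto
  have bc: "gdom G b = gran G c" using dom_ran_of_comp[OF arr(1,2) z(4)] z(5) by simp
  have "gran G (gcomp G b c) = gran G b" using dom_ran_of_comp[OF arr(2,3) bc] by simp
  then have "gcomp G a (gcomp G b c) \<in> A \<odot> (B \<odot> C)"
    using z bc by (intro setcompI) simp_all
  then show "z \<in> A \<odot> (B \<odot> C)" unfolding z(6) comp_assoc[OF arr z(4) bc] .
next
  fix z assume "z \<in> A \<odot> (B \<odot> C)"
  then obtain a b c where z: "a \<in> A" "b \<in> B" "c \<in> C" "gdom G b = gran G c"
    "gdom G a = gran G (gcomp G b c)" "z = gcomp G a (gcomp G b c)"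
    unfolding setcomp_def by blast
  then have arr: "a \<in> arrows G" "b \<in> arrows G" "c \<in> arrows G" using assms by auto
  have ab: "gdom G a = gran G b" using dom_ran_of_comp[OF arr(2,3) z(4)] z(5) by simp
  have "gdom G (gcomp G a b) = gdom G b" using dom_ran_of_comp[OF arr(1,2) ab] by simp
  then have "gcomp G (gcomp G a b) c \<in> (A \<odot> B) \<odot> C"
    using z ab by (intro setcompI) simp_all
  then show "z \<in> (A \<odot> B) \<odot> C" unfolding z(6) comp_assoc[OF arr ab z(4)] .
qed

text \<open>
  An arrow \<open>x\<close> of \<open>A\<close> is a product \<open>a b c\<close> with \<open>a\<close>, \<open>c\<close> in \<open>A\<close>. Since \<open>a\<close> shares its target with \<open>x\<close> and
  \<open>c\<close> its source, both equal \<open>x\<close>, and cancelling in \<open>x = x b x\<close> shows that \<open>b\<close> is inverse to \<open>x\<close>. Applied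
  in both directions, this makes inverses in \<open>Kfin G\<close> unique.
\<close>
lemma regular_imp_subset_ginv:
  assumes A: "local_bisection G A" and B: "local_bisection G B" and eq: "A \<odot> B \<odot> A = A"
  shows "A \<subseteq> ginv ` B"
proof
  fix x assume x: "x \<in> A"
  then have "x \<in> A \<odot> B \<odot> A" using eq by simp
  then obtain a b c where z: "a \<in> A" "b \<in> B" "c \<in> A" "gdom G a = gran G b"
    "gdom G (gcomp G a b) = gran G c" "x = gcomp G (gcomp G a b) c"
    unfolding setcomp_def by blast
  then have arr: "a \<in> arrows G" "b \<in> arrows G" "c \<in> arrows G"
    using bisection_arrow[OF A] bisection_arrow[OF B] by auto
  note ab = comp_closed[OF arr(1,2) z(4)] dom_ran_of_comp[OF arr(1,2) z(4)]
  have "gdom G x = gdom G c" "gran G x = gran G a"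
    unfolding z(6) using dom_ran_of_comp[OF ab(1) arr(3) z(5)] ab(2) by simp_all
  then have ac: "a = x" "c = x"
    using bisection_eqI(2)[OF A z(1) x] bisection_eqI(1)[OF A z(3) x] by (metis)+
  have xa: "x \<in> arrows G" using arr(1) unfolding ac .
  have xb: "gdom G x = gran G b" using z(4) unfolding ac .
  have bx: "gdom G b = gran G x" using z(5) ab(2) unfolding ac by simp
  note bx_props = comp_closed[OF arr(2) xa bx] dom_ran_of_comp[OF arr(2) xa bx]
  have xbx: "gdom G x = gran G (gcomp G b x)" using bx_props(2) xb by simp
  have x_eq: "gcomp G x (gcomp G b x) = x"
    using z(6) comp_assoc[OF xa arr(2) xa xb bx] unfolding ac by (rule sym[OF trans])
  have "gcomp G b x = gcomp G (gdom G x) (gcomp G b x)"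
    unfolding xbx by (rule comp_ran[OF bx_props(1), symmetric])
  also have "\<dots> = gcomp G (gcomp G (ginv x) x) (gcomp G b x)"
    unfolding ginv_props(4)[OF xa] ..
  also have "\<dots> = gcomp G (ginv x) (gcomp G x (gcomp G b x))"
    by (rule comp_assoc[OF ginv_props(1)[OF xa] xa bx_props(1) ginv_props(2)[OF xa] xbx])
  also have "\<dots> = gdom G x" unfolding x_eq by (rule ginv_props(4)[OF xa])
  finally have "gcomp G b x = gran G b" unfolding xb .
  then have "x = ginv b" by (rule ginv_equality[OF arr(2) xa bx])
  then show "x \<in> ginv ` B" using z(2) by blast
qed

lemma ginv_ginv: "a \<in> arrows G \<Longrightarrow> ginv (ginv a) = a"
  by (rule ginv_equality[symmetric]) (simp_all add: ginv_props)

lemma ginv_image_Kfin: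
  assumes "A \<in> carrier (Kfin G)" shows "ginv ` A \<in> carrier (Kfin G)"
proof -
  have A: "local_bisection G A" "finite A" using assms by (simp_all add: carrier_Kfin)
  note p = ginv_props(1-3)[OF bisection_arrow[OF A(1)]]
  have "ginv a = ginv b" if "a \<in> A" "b \<in> A" "gdom G (ginv a) = gdom G (ginv b) \<or> gran G (ginv a) = gran G (ginv b)" for a b
  proof -
    have "a = b" using that(3) bisection_eqI[OF A(1) that(1,2)] unfolding p[OF that(1)] p[OF that(2)] by blast
    then show ?thesis by simp
  qed
  moreover have "ginv ` A \<subseteq> arrows G" using p(1) by blast
  ultimately have "local_bisection G (ginv ` A)"
    unfolding local_bisection_def by blast
  then show ?thesis using A by (simp add: carrier_Kfin)
qed

text \<open>
  Multiplying by \<open>D\<^sup>-\<^sup>1 D\<close> restricts \<open>A\<close> to the sources of \<open>D\<close>. This yields both regularity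
  (\<open>D = A\<close>) and the description of the natural order as inclusion.
\<close>
lemma dom_restrict:
  assumes A: "A \<subseteq> arrows G" and D: "local_bisection G D"
  shows "A \<odot> ginv ` D \<odot> D = {a \<in> A. gdom G a \<in> gdom G ` D}"
proof -
  have D': "D \<subseteq> arrows G" using D by (simp add: local_bisection_def)
  note p = ginv_props[OF subsetD[OF D']]
  have iD: "ginv ` D \<subseteq> arrows G" using p(1) by blast
  have dD: "ginv ` D \<odot> D = gdom G ` D"
  proof (intro equalityI subsetI)
    fix x assume "x \<in> ginv ` D \<odot> D"
    then obtain d e where de: "d \<in> D" "e \<in> D" "gdom G (ginv d) = gran G e" "x = gcomp G (ginv d) e"
      unfolding setcomp_def by blast
    have "d = e" by (rule bisection_eqI(2)[OF D de(1,2)]) (use de(3) p(2)[OF de(1)] in simp)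
    then have "x = gdom G d" using de(4) p(4)[OF de(1)] by simp
    then show "x \<in> gdom G ` D" using de(1) by blast
  next
    fix x assume "x \<in> gdom G ` D"
    then obtain d where d: "d \<in> D" "x = gdom G d" by blast
    have "gcomp G (ginv d) d \<in> ginv ` D \<odot> D"
      using d p(2) by (intro setcompI) simp_all
    then show "x \<in> ginv ` D \<odot> D" unfolding d(2) p(4)[OF d(1)] .
  qed
  have "A \<odot> gdom G ` D = {a \<in> A. gdom G a \<in> gdom G ` D}"
  proof (intro equalityI subsetI)
    fix x assume "x \<in> A \<odot> gdom G ` D"
    then obtain a d where ad: "a \<in> A" "d \<in> D" "gdom G a = gran G (gdom G d)" "x = gcomp G a (gdom G d)"
      unfolding setcomp_def by blast
    have d: "gdom G a = gdom G d" using ad(3) dom_ran_of_dom[OF subsetD[OF D' ad(2)]] by simp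
    have "x = a" unfolding ad(4) d[symmetric] by (rule comp_dom[OF subsetD[OF A ad(1)]])
    then show "x \<in> {a \<in> A. gdom G a \<in> gdom G ` D}" using ad(1,2) d by simp
  next
    fix a assume "a \<in> {a \<in> A. gdom G a \<in> gdom G ` D}"
    then have a: "a \<in> A" "gdom G a \<in> gdom G ` D" by simp_all
    have "gcomp G a (gdom G a) \<in> A \<odot> gdom G ` D"
      using a dom_ran_of_dom[OF subsetD[OF A a(1)]] by (intro setcompI) simp_all
    then show "a \<in> A \<odot> gdom G ` D" unfolding comp_dom[OF subsetD[OF A a(1)]] .
  qed
  then show ?thesis using dD setcomp_assoc[OF A iD D'] by simp
qed

lemma inverse_semigroup_Kfin: "inverse_semigroup (Kfin G)"
proof
  fix A B assume "A \<in> carrier (Kfin G)" "B \<in> carrier (Kfin G)"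
  then show "A \<cdot>\<^bsub>Kfin G\<^esub> B \<in> carrier (Kfin G)" by (simp add: smul_Kfin Kfin_closed)
next
  fix A B C assume "A \<in> carrier (Kfin G)" "B \<in> carrier (Kfin G)" "C \<in> carrier (Kfin G)"
  then show "A \<cdot>\<^bsub>Kfin G\<^esub> B \<cdot>\<^bsub>Kfin G\<^esub> C = A \<cdot>\<^bsub>Kfin G\<^esub> (B \<cdot>\<^bsub>Kfin G\<^esub> C)"
    unfolding smul_Kfin by (intro setcomp_assoc) (auto simp: carrier_Kfin local_bisection_def)
next
  have reg: "A \<odot> ginv ` A \<odot> A = A" if "A \<in> carrier (Kfin G)" for A
  proof -
    have "local_bisection G A" using that by (simp add: carrier_Kfin)
    then show ?thesis using dom_restrict[of A A] by (auto simp: local_bisection_def)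
  qed
  fix A assume A: "A \<in> carrier (Kfin G)"
  have lA: "local_bisection G A" and iA: "ginv ` A \<in> carrier (Kfin G)"
    using A ginv_image_Kfin by (simp_all add: carrier_Kfin)
  have ii: "ginv ` (ginv ` A) = A"
    using ginv_ginv bisection_arrow[OF lA] by (auto simp: image_image)
  show "\<exists>!B. B \<in> carrier (Kfin G) \<and> A \<cdot>\<^bsub>Kfin G\<^esub> B \<cdot>\<^bsub>Kfin G\<^esub> A = A \<and> B \<cdot>\<^bsub>Kfin G\<^esub> A \<cdot>\<^bsub>Kfin G\<^esub> B = B"
    unfolding smul_Kfin
  proof (rule ex1I[of _ "ginv ` A"])
    show "ginv ` A \<in> carrier (Kfin G) \<and> A \<odot> ginv ` A \<odot> A = A \<and> ginv ` A \<odot> A \<odot> ginv ` A = ginv ` A"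
      using iA reg[OF A] reg[OF iA] ii by simp
  next
    fix B assume "B \<in> carrier (Kfin G) \<and> A \<odot> B \<odot> A = A \<and> B \<odot> A \<odot> B = B"
    then have B: "local_bisection G B" "A \<odot> B \<odot> A = A" "B \<odot> A \<odot> B = B"
      by (simp_all add: carrier_Kfin)
    have "A \<subseteq> ginv ` B" "B \<subseteq> ginv ` A"
      using regular_imp_subset_ginv lA B by blast+
    moreover from this(1) have "ginv ` A \<subseteq> B"
      using ginv_ginv bisection_arrow[OF B(1)] by force
    ultimately show "B = ginv ` A" by blast
  qed
qed

lemma sinv_Kfin:
  assumes A: "A \<in> carrier (Kfin G)"
  shows "sinv (Kfin G) A = ginv ` A"
proof -
  interpret K: inverse_semigroup "Kfin G" by (rule inverse_semigroup_Kfin)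
  let ?P = "\<lambda>B. B \<in> carrier (Kfin G) \<and> A \<cdot>\<^bsub>Kfin G\<^esub> B \<cdot>\<^bsub>Kfin G\<^esub> A = A \<and> B \<cdot>\<^bsub>Kfin G\<^esub> A \<cdot>\<^bsub>Kfin G\<^esub> B = B"
  have s: "?P (sinv (Kfin G) A)"
    unfolding sinv_def using theI'[OF K.unique_inverse[OF A]] .
  then have l: "local_bisection G (sinv (Kfin G) A)" "local_bisection G A"
    using A by (simp_all add: carrier_Kfin)
  have "A \<subseteq> ginv ` sinv (Kfin G) A" "sinv (Kfin G) A \<subseteq> ginv ` A"
    using regular_imp_subset_ginv l s unfolding smul_Kfin by blast+
  moreover from this(1) have "ginv ` A \<subseteq> sinv (Kfin G) A"
    using ginv_ginv bisection_arrow[OF l(1)] by force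
  ultimately show ?thesis by blast
qed

lemma natural_order_Kfin:
  assumes A: "A \<in> carrier (Kfin G)" and B: "B \<in> carrier (Kfin G)"
  shows "A \<sqsubseteq>\<^bsub>natural_order (Kfin G)\<^esub> B \<longleftrightarrow> A \<subseteq> B"
proof -
  have l: "local_bisection G A" "local_bisection G B" using A B by (simp_all add: carrier_Kfin)
  have "A \<sqsubseteq>\<^bsub>natural_order (Kfin G)\<^esub> B \<longleftrightarrow> A = {b \<in> B. gdom G b \<in> gdom G ` A}"
    using dom_restrict[of B A] l
    by (simp add: natural_order_def smul_Kfin sinv_Kfin[OF A] local_bisection_def)
  also have "\<dots> \<longleftrightarrow> A \<subseteq> B"
    using bisection_eqI(1)[OF l(2)] by blast
  finally show ?thesis .
qed

lemma semisimple_Kfin: "semisimple (Kfin G)"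
  unfolding semisimple_def
proof
  fix A assume A: "A \<in> carrier (Kfin G)"
  have "{X \<in> carrier (Kfin G). X \<sqsubseteq>\<^bsub>natural_order (Kfin G)\<^esub> A} \<subseteq> Pow A"
    using natural_order_Kfin A by blast
  then show "finite {X \<in> carrier (Kfin G). X \<sqsubseteq>\<^bsub>natural_order (Kfin G)\<^esub> A}"
    by (rule finite_subset) (use A in \<open>simp add: carrier_Kfin\<close>)
qed

text \<open>
  If \<open>E\<close> is idempotent, an arrow \<open>x\<close> of \<open>E\<close> is a product \<open>a b\<close> of arrows of \<open>E\<close> sharing its target and its
  source respectively, so \<open>x = x x\<close>, and cancelling shows that \<open>x\<close> is an identity.
\<close>
lemma idempotents_Kfin: "idempotents (Kfin G) = {E. finite E \<and> E \<subseteq> gdom G ` arrows G}"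
proof (intro equalityI subsetI)
  fix E assume "E \<in> idempotents (Kfin G)"
  then have E: "finite E" "local_bisection G E" "E \<odot> E = E"
    by (simp_all add: idempotents_def carrier_Kfin smul_Kfin)
  have "x \<in> gdom G ` arrows G" if x: "x \<in> E" for x
  proof -
    obtain a b where ab: "a \<in> E" "b \<in> E" "gdom G a = gran G b" "x = gcomp G a b"
      using x E(3) unfolding setcomp_def by blast
    then have arr: "a \<in> arrows G" "b \<in> arrows G" using bisection_arrow[OF E(2)] by auto
    have "gran G x = gran G a" "gdom G x = gdom G b"
      unfolding ab(4) using dom_ran_of_comp[OF arr ab(3)] by simp_all
    then have xx: "a = x" "b = x"
      using bisection_eqI(2)[OF E(2) ab(1) x] bisection_eqI(1)[OF E(2) ab(2) x] by metis+
    have x_arr: "x \<in> arrows G" and x_loop: "gdom G x = gran G x" and x_idem: "gcomp G x x = x"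
      using arr(1) ab(3) ab(4)[symmetric] unfolding xx by simp_all
    note i = ginv_props[OF x_arr]
    have "x = gcomp G (gcomp G (ginv x) x) x"
      unfolding i(4) x_loop by (rule comp_ran[OF x_arr, symmetric])
    also have "\<dots> = gcomp G (ginv x) (gcomp G x x)"
      by (rule comp_assoc[OF i(1) x_arr x_arr i(2) x_loop])
    also have "\<dots> = gdom G x" unfolding x_idem by (rule i(4))
    finally show ?thesis using x_arr by blast
  qed
  then show "E \<in> {E. finite E \<and> E \<subseteq> gdom G ` arrows G}" using E by blast
next
  fix E assume "E \<in> {E. finite E \<and> E \<subseteq> gdom G ` arrows G}"
  then have E: "finite E" "E \<subseteq> gdom G ` arrows G" by auto
  have p: "x \<in> arrows G" "gdom G x = x" "gran G x = x" if x: "x \<in> E" for x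
    using x E(2) dom_closed dom_ran_of_dom by auto
  have p': "gcomp G x x = x" if x: "x \<in> E" for x
    using comp_dom[OF p(1)[OF x]] p(2)[OF x] by simp
  have "local_bisection G E" unfolding local_bisection_def using p by (simp add: subset_iff)
  moreover have "E \<odot> E = E"
  proof (intro equalityI subsetI)
    fix x assume "x \<in> E \<odot> E"
    then obtain e f where "e \<in> E" "f \<in> E" "gdom G e = gran G f" "x = gcomp G e f"
      unfolding setcomp_def by blast
    then show "x \<in> E" using p(2,3) p' by simp
  next
    fix x assume x: "x \<in> E"
    have "gcomp G x x \<in> E \<odot> E" using x p(2,3) by (intro setcompI) simp_all
    then show "x \<in> E \<odot> E" unfolding p'[OF x] .
  qed
  ultimately show "E \<in> idempotents (Kfin G)"
    using E by (simp add: idempotents_def carrier_Kfin smul_Kfin)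
qed

text \<open>
  If \<open>a \<in> A\<close> and \<open>b \<in> B\<close> have the same source, then \<open>a b\<^sup>-\<^sup>1\<close> is an arrow of the product of \<open>A\<close> with the
  inverse of \<open>B\<close>, hence an identity, so \<open>a = b\<close>; likewise for targets.
\<close>
lemma compatible_Kfin_union:
  assumes A: "A \<in> carrier (Kfin G)" and B: "B \<in> carrier (Kfin G)" and c: "compatible (Kfin G) A B"
  shows "A \<union> B \<in> carrier (Kfin G)"
proof -
  have l: "local_bisection G A" "local_bisection G B" using A B by (simp_all add: carrier_Kfin)
  note arr = bisection_arrow[OF l(1)] bisection_arrow[OF l(2)]
  have ids: "ginv ` A \<odot> B \<subseteq> gdom G ` arrows G" "A \<odot> ginv ` B \<subseteq> gdom G ` arrows G"
    using c unfolding compatible_def smul_Kfin sinv_Kfin[OF A] sinv_Kfin[OF B] idempotents_Kfin by auto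
  have idd: "gdom G x = x" "gran G x = x" if "x \<in> gdom G ` arrows G" for x
    using that dom_ran_of_dom by auto
  have d: "a = b" if "a \<in> A" "b \<in> B" "gdom G a = gdom G b" for a b
  proof -
    note i = ginv_props[OF arr(2)[OF that(2)]]
    have "gcomp G a (ginv b) \<in> A \<odot> ginv ` B"
      using that i by (intro setcompI) simp_all
    then have "gdom G (gcomp G a (ginv b)) = gcomp G a (ginv b)" using ids idd by blast
    then have "gcomp G a (ginv b) = gran G b"
      using dom_ran_of_comp[OF arr(1)[OF that(1)] i(1)] i that by simp
    then show ?thesis using comp_ginv_identity_right arr that by blast
  qed
  have r: "a = b" if "a \<in> A" "b \<in> B" "gran G a = gran G b" for a b
  proof -
    note i = ginv_props[OF arr(1)[OF that(1)]]
    have "gcomp G (ginv a) b \<in> ginv ` A \<odot> B"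
      using that i by (intro setcompI) simp_all
    then have "gdom G (gcomp G (ginv a) b) = gcomp G (ginv a) b" using ids idd by blast
    then have "gcomp G (ginv a) b = gdom G b"
      using dom_ran_of_comp[OF i(1) arr(2)[OF that(2)]] i that by simp
    then show ?thesis using comp_ginv_identity_left arr that by blast
  qed
  have "(gdom G a = gdom G b \<longrightarrow> a = b) \<and> (gran G a = gran G b \<longrightarrow> a = b)"
    if "a \<in> A \<union> B" "b \<in> A \<union> B" for a b
    using that bisection_eqI[OF l(1), of a b] bisection_eqI[OF l(2), of a b]
      d[of a b] d[of b a] r[of a b] r[of b a] by (metis UnE)
  moreover have "A \<union> B \<subseteq> arrows G" using arr by blast
  ultimately have "local_bisection G (A \<union> B)"
    unfolding local_bisection_def by blast
  then show ?thesis using A B by (simp add: carrier_Kfin)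
qed

lemma is_lub_Kfin:
  assumes A: "A \<in> carrier (Kfin G)" and B: "B \<in> carrier (Kfin G)" and U: "A \<union> B \<in> carrier (Kfin G)"
  shows "is_lub (natural_order (Kfin G)) J {A, B} \<longleftrightarrow> J = A \<union> B"
proof -
  have c: "carrier (natural_order (Kfin G)) = carrier (Kfin G)" by (simp add: natural_order_def)
  have *: "Upper (natural_order (Kfin G)) {A, B} = {U \<in> carrier (Kfin G). A \<union> B \<subseteq> U}"
    unfolding Upper_def c using natural_order_Kfin A B by blast
  show ?thesis
    unfolding least_def * c using natural_order_Kfin U by blast
qed

theorem boolean_inverse_semigroup_Kfin:
  assumes "arrows G \<noteq> {}"
  shows "boolean_inverse_semigroup (Kfin G)"
proof -
  interpret K: inverse_semigroup "Kfin G" by (rule inverse_semigroup_Kfin)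
  have fin: "finite_subset_lattice (idempotent_order (Kfin G)) (gdom G ` arrows G)"
  proof
    fix E F assume "E \<in> carrier (idempotent_order (Kfin G))" "F \<in> carrier (idempotent_order (Kfin G))"
    then show "E \<sqsubseteq>\<^bsub>idempotent_order (Kfin G)\<^esub> F \<longleftrightarrow> E \<subseteq> F"
      using natural_order_Kfin[of E F] by (simp add: idempotent_order_def idempotents_def)
  qed (simp_all add: idempotent_order_def idempotents_Kfin, simp add: natural_order_def)
  have "distributive_inverse_semigroup (Kfin G)"
  proof
    show "\<exists>z\<in>carrier (Kfin G). \<forall>a\<in>carrier (Kfin G). z \<cdot>\<^bsub>Kfin G\<^esub> a = z \<and> a \<cdot>\<^bsub>Kfin G\<^esub> z = z"
      by (rule bexI[of _ "{}"]) (simp_all add: smul_Kfin setcomp_def carrier_Kfin local_bisection_def)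
  next
    fix A B assume "A \<in> carrier (Kfin G)" "B \<in> carrier (Kfin G)" "compatible (Kfin G) A B"
    then show "\<exists>J. is_lub (natural_order (Kfin G)) J {A, B}"
      using is_lub_Kfin compatible_Kfin_union by blast
  next
    fix A B C J
    assume A: "A \<in> carrier (Kfin G)" "B \<in> carrier (Kfin G)" and C: "C \<in> carrier (Kfin G)"
      and c: "compatible (Kfin G) A B" and J: "is_lub (natural_order (Kfin G)) J {A, B}"
    have U: "A \<union> B \<in> carrier (Kfin G)" by (rule compatible_Kfin_union[OF A c])
    have J: "J = A \<union> B" using J is_lub_Kfin[OF A U] by simp
    have d: "C \<odot> (A \<union> B) = C \<odot> A \<union> C \<odot> B" "(A \<union> B) \<odot> C = A \<odot> C \<union> B \<odot> C"
      unfolding setcomp_def by auto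
    have "C \<odot> (A \<union> B) \<in> carrier (Kfin G)" "(A \<union> B) \<odot> C \<in> carrier (Kfin G)"
      using Kfin_closed U C by blast+
    then show "is_lub (natural_order (Kfin G)) (C \<cdot>\<^bsub>Kfin G\<^esub> J) {C \<cdot>\<^bsub>Kfin G\<^esub> A, C \<cdot>\<^bsub>Kfin G\<^esub> B}"
      "is_lub (natural_order (Kfin G)) (J \<cdot>\<^bsub>Kfin G\<^esub> C) {A \<cdot>\<^bsub>Kfin G\<^esub> C, B \<cdot>\<^bsub>Kfin G\<^esub> C}"
      using is_lub_Kfin Kfin_closed A C by (simp_all add: smul_Kfin J d)
  qed
  moreover have "generalized_boolean_algebra (idempotent_order (Kfin G))"
    by (rule finite_subset_lattice.generalized_boolean[OF fin])
  moreover have "\<nexists>Z. carrier (Kfin G) = {Z}"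
  proof -
    obtain a where "a \<in> arrows G" using assms by blast
    then have "{a} \<in> carrier (Kfin G)" "{} \<in> carrier (Kfin G)"
      by (simp_all add: carrier_Kfin local_bisection_def)
    then show ?thesis by (metis insert_not_empty singletonD)
  qed
  ultimately show ?thesis
    by (intro boolean_inverse_semigroup.intro boolean_inverse_semigroup_axioms.intro)
qed

end

section \<open>The characterization\<close>

text \<open>
  A multiplicative bijection preserves inverses, which are defined by equations, and so is monotone.
  It embeds each order ideal of \<open>S\<close> into an order ideal of \<open>T\<close>.
\<close>
lemma semisimple_isomorphic:
  assumes S: "inverse_semigroup S" and T: "inverse_semigroup T"
    and iso: "semigroup_isomorphic S T" and ss: "semisimple T"
  shows "semisimple S"
proof -
  interpret S: inverse_semigroup S by (rule S)
  interpret T: inverse_semigroup T by (rule T)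
  obtain f where bij: "bij_betw f (carrier S) (carrier T)"
    and hom: "\<And>a b. a \<in> carrier S \<Longrightarrow> b \<in> carrier S \<Longrightarrow> f (a \<cdot>\<^bsub>S\<^esub> b) = f a \<cdot>\<^bsub>T\<^esub> f b"
    using iso unfolding semigroup_isomorphic_def by blast
  have f: "f a \<in> carrier T" if "a \<in> carrier S" for a using bij that by (rule bij_betwE[THEN bspec])
  have inv: "sinv T (f a) = f (sinv S a)" if a: "a \<in> carrier S" for a
  proof (rule T.sinv_equality)
    note p = S.sinv_props[OF a]
    show "f a \<cdot>\<^bsub>T\<^esub> f (sinv S a) \<cdot>\<^bsub>T\<^esub> f a = f a"
      using arg_cong[OF p(2), of f] by (simp add: hom a p(1) S.mult_closed)
    show "f (sinv S a) \<cdot>\<^bsub>T\<^esub> f a \<cdot>\<^bsub>T\<^esub> f (sinv S a) = f (sinv S a)"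
      using arg_cong[OF p(3), of f] by (simp add: hom a p(1) S.mult_closed)
  qed (simp_all add: f a S.sinv_props(1))
  have mono: "f x \<sqsubseteq>\<^bsub>natural_order T\<^esub> f a"
    if a: "a \<in> carrier S" and x: "x \<in> carrier S" and le: "x \<sqsubseteq>\<^bsub>natural_order S\<^esub> a" for a x
  proof -
    have "x = a \<cdot>\<^bsub>S\<^esub> sinv S x \<cdot>\<^bsub>S\<^esub> x" using le by (simp add: natural_order_def)
    then have "f x = f (a \<cdot>\<^bsub>S\<^esub> sinv S x \<cdot>\<^bsub>S\<^esub> x)" by (rule arg_cong)
    also have "\<dots> = f a \<cdot>\<^bsub>T\<^esub> sinv T (f x) \<cdot>\<^bsub>T\<^esub> f x"
      by (simp add: hom a x inv S.sinv_props(1) S.mult_closed)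
    finally show ?thesis by (simp add: natural_order_def)
  qed
  show ?thesis
    unfolding semisimple_def
  proof
    fix a assume a: "a \<in> carrier S"
    let ?D = "{x \<in> carrier S. x \<sqsubseteq>\<^bsub>natural_order S\<^esub> a}"
    have "f ` ?D \<subseteq> {y \<in> carrier T. y \<sqsubseteq>\<^bsub>natural_order T\<^esub> f a}"
      using mono[OF a] f by blast
    moreover have "finite {y \<in> carrier T. y \<sqsubseteq>\<^bsub>natural_order T\<^esub> f a}"
      using ss f[OF a] unfolding semisimple_def by blast
    ultimately have "finite (f ` ?D)" by (rule finite_subset)
    moreover have "inj_on f ?D"
      using bij by (auto simp: bij_betw_def intro: inj_on_subset)
    ultimately show "finite ?D" by (rule finite_imageD)
  qed
qed

lemma isomorphic_Kfin_imp_semisimple: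
  assumes "boolean_inverse_semigroup S" "groupoid G" "semigroup_isomorphic S (Kfin G)"
  shows "semisimple S"
proof -
  have "inverse_semigroup S"
    using assms(1) by (simp add: boolean_inverse_semigroup_def distributive_inverse_semigroup_def)
  then show ?thesis
    using assms(2,3) groupoid.inverse_semigroup_Kfin groupoid.semisimple_Kfin semisimple_isomorphic
    by blast
qed

theorem corollary5p8:
  fixes S :: "'a semigroup_on" and G :: "'g groupoid"
  shows "(boolean_inverse_semigroup S \<longrightarrow>
            (semisimple S \<longleftrightarrow> (\<exists>H :: 'a groupoid. groupoid H \<and> semigroup_isomorphic S (Kfin H))))
       \<and> (boolean_inverse_semigroup S \<and> groupoid G \<and> semigroup_isomorphic S (Kfin G)
            \<longrightarrow> semisimple S)
       \<and> (groupoid G \<and> arrows G \<noteq> {}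
            \<longrightarrow> boolean_inverse_semigroup (Kfin G) \<and> semisimple (Kfin G))"
proof (intro conjI impI)
  assume S: "boolean_inverse_semigroup S"
  show "semisimple S \<longleftrightarrow> (\<exists>H :: 'a groupoid. groupoid H \<and> semigroup_isomorphic S (Kfin H))"
  proof
    assume "semisimple S"
    interpret boolean_inverse_semigroup S by (rule S)
    show "\<exists>H :: 'a groupoid. groupoid H \<and> semigroup_isomorphic S (Kfin H)"
      using groupoid_atoms semisimple_imp_isomorphic_Kfin[OF \<open>semisimple S\<close>] by blast
  next
    assume "\<exists>H :: 'a groupoid. groupoid H \<and> semigroup_isomorphic S (Kfin H)"
    then show "semisimple S" using isomorphic_Kfin_imp_semisimple[OF S] by blast
  qed
next
  assume "boolean_inverse_semigroup S \<and> groupoid G \<and> semigroup_isomorphic S (Kfin G)"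
  then show "semisimple S" using isomorphic_Kfin_imp_semisimple by blast
next
  assume "groupoid G \<and> arrows G \<noteq> {}"
  then show "boolean_inverse_semigroup (Kfin G)" "semisimple (Kfin G)"
    using groupoid.boolean_inverse_semigroup_Kfin groupoid.semisimple_Kfin by blast+
qed

end
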